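(* Let $(G/H,F)$ be a homogeneous Finsler manifold with a given reductive decomposition $\mathfrak g=\mathfrak h+\mathfrak m$. If $(G/H,F)$ is both cyclic and naturally reductive with respect to this reductive decomposition, then the decomposition is a Cartan decomposition, that is, $[\mathfrak m,\mathfrak m]\subset\mathfrak h$; in other words, the homogeneous Finsler manifold $(G/H,F)$ is a symmetric space.
   Context: Let $G$ be a Lie group with Lie algebra $\mathfrak g$, and $H\subset G$ a closed subgroup with Lie algebra $\mathfrak h$. A reductive decomposition is an $\mathrm{Ad}(H)$-invariant vector space direct sum $\mathfrak g=\mathfrak h+\mathfrak m$ (so $[\mathfrak h,\mathfrak m]\subset\mathfrak m$); $\mathfrak m$ is identified with the tangent space $T_o(G/H)$ at $o=eH$, and $[\cdot,\cdot]_{\mathfrak m}$ denotes the $\mathfrak m$-component of the Lie bracket. A Minkowski norm on a finite-dimensional real vector space $V$ is a continuous function $F:V\to[0,\infty)$, positive and smooth on $V\setminus\{0\}$, with $F(\lambda y)=\lambda F(y)$ for $\lambda\ge 0$, such that for every $y\neq0$ the fundamental tensor $$\langle u,v\rangle_y=\tfrac12\tfrac{\partial^2}{\partial s\partial t}\Big|_{s=t=0}F^2(y+su+tv)$$ is positive definite. Its Cartan tensor is $C_y(u,v,w)=\tfrac12\tfrac{d}{dt}|_{t=0}\langle u,v\rangle_{y+tw}$. A $G$-invariant Finsler metric on $G/H$ is determined one-to-one by an $\mathrm{Ad}(H)$-invariant Minkowski norm on $\mathfrak m$, its restriction to $T_o(G/H)=\mathfrak m$, also denoted $F$; $(G/H,F)$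 is then called a homogeneous Finsler manifold, and $\langle\cdot,\cdot\rangle_y$ and $C_y$ below refer to this Minkowski norm on $\mathfrak m$. $(G/H,F)$ is cyclic with respect to $\mathfrak g=\mathfrak h+\mathfrak m$ if $$\langle[x,y]_{\mathfrak m},z\rangle_y+\langle[y,z]_{\mathfrak m},x\rangle_y+\langle[z,x]_{\mathfrak m},y\rangle_y=0\quad\text{for all } y\in\mathfrak m\setminus\{0\},\ x,z\in\mathfrak m.$$ $(G/H,F)$ is naturally reductive with respect to $\mathfrak g=\mathfrak h+\mathfrak m$ if $$\langle[x,u]_{\mathfrak m},v\rangle_y+\langle[x,v]_{\mathfrak m},u\rangle_y+2C_y([x,y]_{\mathfrak m},u,v)=0\quad\text{for all } y\in\mathfrak m\setminus\{0\},\ x,u,v\in\mathfrak m.$$ Here "symmetric" is used in the sense that the reductive decomposition is a Cartan decomposition, i.e. $[\mathfrak h,\mathfrak h]\subset\mathfrak h$, $[\mathfrak h,\mathfrak m]\subset\mathfrak m$ and $[\mathfrak m,\mathfrak m]\subset\mathfrak h$. *)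

theory Defs
  imports "HOL-Analysis.Analysis" "HOL-Algebra.Group"
begin

section \<open>Smooth functions on open subsets of a finite-dimensional vector space\<close>

text \<open>
  \<open>V\<close> is a linear subspace of the ambient type and \<open>S\<close> is relatively open in \<open>V\<close>.
  A function is \<open>C\<^sup>k\<close> on \<open>S\<close> if all its iterated directional derivatives of order at most \<open>k\<close>,
  in directions from \<open>V\<close>, exist and are continuous on \<open>S\<close>. For finite-dimensional \<open>V\<close> this is
  the usual notion (continuous partial derivatives up to order \<open>k\<close>), without a choice of basis.
  Values of \<open>f\<close> outside \<open>S\<close> are irrelevant, since \<open>S\<close> is open in \<open>V\<close>.
\<close>

primrec Ck_on ::
  "nat \<Rightarrow> 'a::real_normed_vector set \<Rightarrow> 'a set \<Rightarrow> ('a \<Rightarrow> 'b::real_normed_vector) \<Rightarrow> bool"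
where
  "Ck_on 0 V S f \<longleftrightarrow> continuous_on S f"
| "Ck_on (Suc k) V S f \<longleftrightarrow> continuous_on S f \<and>
     (\<forall>v\<in>V. \<exists>f'. (\<forall>x\<in>S. ((\<lambda>t::real. f (x + t *\<^sub>R v)) has_vector_derivative f' x) (at 0))
                 \<and> Ck_on k V S f')"

definition smooth_on ::
  "'a::real_normed_vector set \<Rightarrow> 'a set \<Rightarrow> ('a \<Rightarrow> 'b::real_normed_vector) \<Rightarrow> bool"
where
  "smooth_on V S f \<longleftrightarrow> (\<forall>k. Ck_on k V S f)"


section \<open>Lie groups\<close>

text \<open>
  A chart is a pair of an open set and a map on it; only the values of the map on that set
  matter. Charts take values in a fixed linear subspace \<open>model G\<close> of a Euclidean space; using a
  subspace rather than the whole Euclidean space keeps the zero-dimensional case.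
\<close>

type_synonym ('g, 'e) chart = "'g set \<times> ('g \<Rightarrow> 'e)"

record ('g, 'e) lie_group_data = "'g monoid" +
  gtop  :: "'g topology"
  model :: "'e set"
  atlas :: "('g, 'e) chart set"

definition chart_inv :: "('g, 'e) chart \<Rightarrow> 'e \<Rightarrow> 'g" where
  "chart_inv \<kappa> = inv_into (fst \<kappa>) (snd \<kappa>)"

definition smooth_atlas ::
  "'g topology \<Rightarrow> 'e::euclidean_space set \<Rightarrow> ('g, 'e) chart set \<Rightarrow> bool"
where
  "smooth_atlas T E A \<longleftrightarrow>
     \<Union> (fst ` A) = topspace T \<and>
     (\<forall>(U, \<phi>) \<in> A. openin T U \<and> openin (top_of_set E) (\<phi> ` U) \<and>
        homeomorphic_map (subtopology T U) (top_of_set (\<phi> ` U)) \<phi>) \<and>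
     (\<forall>(U, \<phi>) \<in> A. \<forall>(V, \<psi>) \<in> A. smooth_on E (\<phi> ` (U \<inter> V)) (\<psi> \<circ> chart_inv (U, \<phi>)))"

locale lie_group = group G
  for G :: "('g, 'e::euclidean_space, 'z) lie_group_data_scheme" (structure) +
  assumes topspace_gtop: "topspace (gtop G) = carrier G"
    and Hausdorff: "Hausdorff_space (gtop G)"
    and second_countable: "second_countable (gtop G)"
    and subspace_model: "subspace (model G)"
    and atlas: "smooth_atlas (gtop G) (model G) (atlas G)"
    and continuous_mult:
      "continuous_map (prod_topology (gtop G) (gtop G)) (gtop G) (\<lambda>(p, q). p \<otimes> q)"
    and smooth_mult:
      "\<lbrakk>(U, \<phi>) \<in> atlas G; (V, \<psi>) \<in> atlas G; (W, \<omega>) \<in> atlas G\<rbrakk> \<Longrightarrow>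
        smooth_on (model G \<times> model G)
          {(x, y). x \<in> \<phi> ` U \<and> y \<in> \<psi> ` V \<and> chart_inv (U, \<phi>) x \<otimes> chart_inv (V, \<psi>) y \<in> W}
          (\<lambda>(x, y). \<omega> (chart_inv (U, \<phi>) x \<otimes> chart_inv (V, \<psi>) y))"
    and continuous_inv: "continuous_map (gtop G) (gtop G) (\<lambda>p. inv p)"
    and smooth_inv:
      "\<lbrakk>(U, \<phi>) \<in> atlas G; (W, \<omega>) \<in> atlas G\<rbrakk> \<Longrightarrow>
        smooth_on (model G) {x \<in> \<phi> ` U. inv (chart_inv (U, \<phi>) x) \<in> W}
          (\<lambda>x. \<omega> (inv (chart_inv (U, \<phi>) x)))"

definition closed_subgroup :: "'g set \<Rightarrow> ('g, 'e, 'z) lie_group_data_scheme \<Rightarrow> bool" where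
  "closed_subgroup H G \<longleftrightarrow> subgroup H G \<and> closedin (gtop G) H"


section \<open>The Lie algebra\<close>

text \<open>
  The Lie algebra is the tangent space at the identity. Through a chart \<open>\<kappa>\<close> around the identity
  it is identified with the vector space \<open>model G\<close>: a vector \<open>v\<close> is the velocity at \<open>t = 0\<close> of
  \<open>chart_line G \<kappa> v\<close>, the curve through the identity which is affine in the chart. The adjoint
  representation is the differential of conjugation at the identity, and the bracket is
  \<open>[u, v] = ad u v\<close> with \<open>ad\<close> the differential of \<open>Ad\<close> at the identity.
\<close>

definition chart_at_one ::
  "('g, 'e, 'z) lie_group_data_scheme \<Rightarrow> ('g, 'e) chart \<Rightarrow> bool"
where
  "chart_at_one G \<kappa> \<longleftrightarrow> \<kappa> \<in> atlas G \<and> \<one>\<^bsub>G\<^esub> \<in> fst \<kappa>"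

definition chart_line ::
  "('g, 'e::real_normed_vector, 'z) lie_group_data_scheme \<Rightarrow> ('g, 'e) chart \<Rightarrow> 'e \<Rightarrow> real \<Rightarrow> 'g"
where
  "chart_line G \<kappa> v t = chart_inv \<kappa> (snd \<kappa> \<one>\<^bsub>G\<^esub> + t *\<^sub>R v)"

definition Ad ::
  "('g, 'e::real_normed_vector, 'z) lie_group_data_scheme \<Rightarrow> ('g, 'e) chart \<Rightarrow> 'g \<Rightarrow> 'e \<Rightarrow> 'e"
where
  "Ad G \<kappa> a v =
     vector_derivative (\<lambda>t. snd \<kappa> (a \<otimes>\<^bsub>G\<^esub> chart_line G \<kappa> v t \<otimes>\<^bsub>G\<^esub> inv\<^bsub>G\<^esub> a)) (at 0)"

definition bracket ::
  "('g, 'e::real_normed_vector, 'z) lie_group_data_scheme \<Rightarrow> ('g, 'e) chart \<Rightarrow> 'e \<Rightarrow> 'e \<Rightarrow> 'e"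
where
  "bracket G \<kappa> u v = vector_derivative (\<lambda>s. Ad G \<kappa> (chart_line G \<kappa> u s) v) (at 0)"

text \<open>
  The Lie algebra of a closed subgroup \<open>H\<close> consists of the \<open>v\<close> with \<open>exp (t v) \<in> H\<close> for all
  real \<open>t\<close>, where \<open>t \<mapsto> exp (t v)\<close> is the one-parameter subgroup with velocity \<open>v\<close> at \<open>0\<close>.
\<close>

definition one_parameter_subgroup ::
  "('g, 'e::real_normed_vector, 'z) lie_group_data_scheme \<Rightarrow> ('g, 'e) chart \<Rightarrow> 'e \<Rightarrow> (real \<Rightarrow> 'g) \<Rightarrow> bool"
where
  "one_parameter_subgroup G \<kappa> v \<gamma> \<longleftrightarrow>
     continuous_map euclideanreal (gtop G) \<gamma> \<and>
     (\<forall>s t. \<gamma> (s + t) = \<gamma> s \<otimes>\<^bsub>G\<^esub> \<gamma> t) \<and>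
     ((\<lambda>t. snd \<kappa> (\<gamma> t)) has_vector_derivative v) (at 0)"

definition subgroup_lie_algebra ::
  "('g, 'e::real_normed_vector, 'z) lie_group_data_scheme \<Rightarrow> ('g, 'e) chart \<Rightarrow> 'g set \<Rightarrow> 'e set"
where
  "subgroup_lie_algebra G \<kappa> H =
     {v \<in> model G. \<exists>\<gamma>. one_parameter_subgroup G \<kappa> v \<gamma> \<and> (\<forall>t. \<gamma> t \<in> H)}"


section \<open>Reductive and Cartan decompositions\<close>

definition direct_sum :: "'e::real_vector set \<Rightarrow> 'e set \<Rightarrow> 'e set \<Rightarrow> bool" where
  "direct_sum V A B \<longleftrightarrow>
     subspace A \<and> subspace B \<and> V = {a + b | a b. a \<in> A \<and> b \<in> B} \<and> A \<inter> B = {0}"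

definition reductive_decomposition ::
  "('g, 'e::real_normed_vector, 'z) lie_group_data_scheme \<Rightarrow> ('g, 'e) chart \<Rightarrow> 'g set \<Rightarrow> 'e set \<Rightarrow> bool"
where
  "reductive_decomposition G \<kappa> H \<mm> \<longleftrightarrow>
     direct_sum (model G) (subgroup_lie_algebra G \<kappa> H) \<mm> \<and>
     (\<forall>a\<in>H. Ad G \<kappa> a ` subgroup_lie_algebra G \<kappa> H \<subseteq> subgroup_lie_algebra G \<kappa> H \<and>
            Ad G \<kappa> a ` \<mm> \<subseteq> \<mm>)"

definition bracket_m ::
  "('g, 'e::real_normed_vector, 'z) lie_group_data_scheme \<Rightarrow> ('g, 'e) chart \<Rightarrow> 'g set \<Rightarrow> 'e set
     \<Rightarrow> 'e \<Rightarrow> 'e \<Rightarrow> 'e"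
where
  "bracket_m G \<kappa> H \<mm> x y =
     (THE w. w \<in> \<mm> \<and> (\<exists>a \<in> subgroup_lie_algebra G \<kappa> H. bracket G \<kappa> x y = a + w))"

definition cartan_decomposition ::
  "('g, 'e::real_normed_vector, 'z) lie_group_data_scheme \<Rightarrow> ('g, 'e) chart \<Rightarrow> 'g set \<Rightarrow> 'e set \<Rightarrow> bool"
where
  "cartan_decomposition G \<kappa> H \<mm> \<longleftrightarrow>
     (let \<hh> = subgroup_lie_algebra G \<kappa> H in
       direct_sum (model G) \<hh> \<mm> \<and>
       (\<forall>x\<in>\<hh>. \<forall>y\<in>\<hh>. bracket G \<kappa> x y \<in> \<hh>) \<and>
       (\<forall>x\<in>\<hh>. \<forall>y\<in>\<mm>. bracket G \<kappa> x y \<in> \<mm>) \<and>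
       (\<forall>x\<in>\<mm>. \<forall>y\<in>\<mm>. bracket G \<kappa> x y \<in> \<hh>))"


section \<open>Minkowski norms and homogeneous Finsler manifolds\<close>

definition fundamental_tensor ::
  "('e::real_normed_vector \<Rightarrow> real) \<Rightarrow> 'e \<Rightarrow> 'e \<Rightarrow> 'e \<Rightarrow> real"
where
  "fundamental_tensor F y u v =
     1/2 * deriv (\<lambda>s. deriv (\<lambda>t. (F (y + s *\<^sub>R u + t *\<^sub>R v))\<^sup>2) 0) 0"

definition cartan_tensor ::
  "('e::real_normed_vector \<Rightarrow> real) \<Rightarrow> 'e \<Rightarrow> 'e \<Rightarrow> 'e \<Rightarrow> 'e \<Rightarrow> real"
where
  "cartan_tensor F y u v w = 1/2 * deriv (\<lambda>t. fundamental_tensor F (y + t *\<^sub>R w) u v) 0"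

text \<open>Only the values of \<open>F\<close> on the vector space \<open>V\<close> are relevant.\<close>

definition minkowski_norm :: "'e::real_normed_vector set \<Rightarrow> ('e \<Rightarrow> real) \<Rightarrow> bool" where
  "minkowski_norm V F \<longleftrightarrow>
     continuous_on V F \<and>
     (\<forall>y\<in>V. 0 \<le> F y) \<and>
     (\<forall>y\<in>V - {0}. 0 < F y) \<and>
     smooth_on V (V - {0}) F \<and>
     (\<forall>y\<in>V. \<forall>c\<ge>0. F (c *\<^sub>R y) = c * F y) \<and>
     (\<forall>y\<in>V - {0}. \<forall>u\<in>V - {0}. 0 < fundamental_tensor F y u u)"

text \<open>
  A \<open>G\<close>-invariant Finsler metric on \<open>G/H\<close> is given by its restriction to the tangent space \<open>\<mm>\<close>
  at the base point, an \<open>Ad(H)\<close>-invariant Minkowski norm.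
\<close>

definition homogeneous_finsler ::
  "('g, 'e::euclidean_space, 'z) lie_group_data_scheme \<Rightarrow> ('g, 'e) chart \<Rightarrow> 'g set \<Rightarrow> 'e set
     \<Rightarrow> ('e \<Rightarrow> real) \<Rightarrow> bool"
where
  "homogeneous_finsler G \<kappa> H \<mm> F \<longleftrightarrow>
     lie_group G \<and> chart_at_one G \<kappa> \<and> closed_subgroup H G \<and>
     reductive_decomposition G \<kappa> H \<mm> \<and>
     minkowski_norm \<mm> F \<and>
     (\<forall>a\<in>H. \<forall>y\<in>\<mm>. F (Ad G \<kappa> a y) = F y)"

definition cyclic ::
  "('g, 'e::real_normed_vector, 'z) lie_group_data_scheme \<Rightarrow> ('g, 'e) chart \<Rightarrow> 'g set \<Rightarrow> 'e set
     \<Rightarrow> ('e \<Rightarrow> real) \<Rightarrow> bool"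
where
  "cyclic G \<kappa> H \<mm> F \<longleftrightarrow>
     (\<forall>y\<in>\<mm> - {0}. \<forall>x\<in>\<mm>. \<forall>z\<in>\<mm>.
        fundamental_tensor F y (bracket_m G \<kappa> H \<mm> x y) z +
        fundamental_tensor F y (bracket_m G \<kappa> H \<mm> y z) x +
        fundamental_tensor F y (bracket_m G \<kappa> H \<mm> z x) y = 0)"

definition naturally_reductive ::
  "('g, 'e::real_normed_vector, 'z) lie_group_data_scheme \<Rightarrow> ('g, 'e) chart \<Rightarrow> 'g set \<Rightarrow> 'e set
     \<Rightarrow> ('e \<Rightarrow> real) \<Rightarrow> bool"
where
  "naturally_reductive G \<kappa> H \<mm> F \<longleftrightarrow>
     (\<forall>y\<in>\<mm> - {0}. \<forall>x\<in>\<mm>. \<forall>u\<in>\<mm>. \<forall>v\<in>\<mm>.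
        fundamental_tensor F y (bracket_m G \<kappa> H \<mm> x u) v +
        fundamental_tensor F y (bracket_m G \<kappa> H \<mm> x v) u +
        2 * cartan_tensor F y (bracket_m G \<kappa> H \<mm> x y) u v = 0)"

end

theory Submission
  imports Defs
begin

text \<open>
  The Finsler part of the argument is pointwise algebra. Fix \<open>y \<noteq> 0\<close> in \<open>\<mm>\<close> and write
  \<open>B x z\<close> for the \<open>\<mm>\<close>-component of \<open>[x, z]\<close> and \<open>g\<close> for the fundamental tensor at \<open>y\<close>. Since \<open>g\<close>
  is homogeneous of degree \<open>0\<close> in \<open>y\<close>, the Cartan tensor at \<open>y\<close> vanishes when its last argument is \<open>y\<close>
  (\<open>cartan_tensor_base_point\<close>). Natural reductivity with \<open>v = y\<close> therefore reads
  \<open>g (B x u) y = - g (B x y) u\<close>. Substituting this into the cyclic identity and using that \<open>B\<close> is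
  antisymmetric, one gets \<open>2 a + b = 0\<close> for \<open>a = g (B x y) z\<close> and \<open>b = g (B y z) x\<close>. Exchanging
  \<open>x\<close> and \<open>z\<close> turns this into \<open>a + 2 b = 0\<close>, so \<open>a = 0\<close>. The choice \<open>z = B x y\<close>
  and positive definiteness give \<open>B x y = 0\<close> (\<open>cyclic_naturally_reductive_imp_zero\<close>).

  What is left is Lie theory, for a bracket that is given as the derivative of \<open>Ad\<close> in a chart: the
  bracket must be antisymmetric, and \<open>\<hh>\<close> and \<open>\<mm>\<close> must be stable under bracketing with \<open>\<hh>\<close>. Let \<open>\<mu>\<close>
  be the group multiplication in coordinates (\<open>cmul\<close>) and \<open>e\<close> the coordinate of the identity. Differentiating
  \<open>(a p a\<inverse>) a = a p\<close> in \<open>p\<close> at the identity gives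
  \<open>D\<mu>(e, x) (Ad\<^sub>x v, 0) = D\<mu>(x, e) (0, v)\<close>; differentiating once more in \<open>x\<close> gives
  \<open>[u, v] = D\<^sup>2\<mu> ((0, v), (u, 0)) - D\<^sup>2\<mu> ((v, 0), (0, u))\<close>, and this is antisymmetric because second
  derivatives are symmetric (\<open>bracket_antisym\<close>).

  For the second point, \<open>Ad\<close> is differentiable at the identity, so \<open>[u, v]\<close> can be computed along any
  curve with velocity \<open>u\<close>, in particular along a one-parameter subgroup in \<open>H\<close>. If a subspace is
  \<open>Ad(H)\<close>-invariant, the values of \<open>Ad\<close> along that curve stay in it, and so does their derivative
  (\<open>bracket_in_Ad_invariant_subspace\<close>).
\<close>

section \<open>Differential calculus with directional derivatives\<close>

lemma increment_bound:
  fixes g :: "real \<Rightarrow> 'b::real_normed_vector"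
  assumes der: "\<And>t. t \<in> closed_segment 0 a \<Longrightarrow> (g has_vector_derivative g' t) (at t)"
    and bound: "\<And>t. t \<in> closed_segment 0 a \<Longrightarrow> norm (g' t - d) \<le> e"
  shows "norm (g a - g 0 - a *\<^sub>R d) \<le> e * \<bar>a\<bar>"
proof -
  have "norm ((g a - a *\<^sub>R d) - (g 0 - 0 *\<^sub>R d)) \<le> e * norm (a - 0)"
  proof (rule differentiable_bound[of "closed_segment 0 a" _ "\<lambda>t h. h *\<^sub>R (g' t - d)"])
    fix t assume t: "t \<in> closed_segment 0 a"
    have "((\<lambda>t. g t - t *\<^sub>R d) has_vector_derivative (g' t - d)) (at t)"
      by (auto intro!: derivative_eq_intros der[OF t])
    then show "((\<lambda>t. g t - t *\<^sub>R d) has_derivative (\<lambda>h. h *\<^sub>R (g' t - d)))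
        (at t within closed_segment 0 a)"
      unfolding has_vector_derivative_def by (rule has_derivative_at_withinI)
    show "onorm (\<lambda>h. h *\<^sub>R (g' t - d)) \<le> e"
      by (rule onorm_le) (use bound[OF t] in \<open>simp add: mult.commute[of e] mult_left_mono\<close>)
  qed auto
  then show ?thesis by (simp add: algebra_simps)
qed

lemma directional_shift:
  fixes f :: "'a::real_normed_vector \<Rightarrow> 'b::real_normed_vector"
  assumes "((\<lambda>t. f ((y + r *\<^sub>R v) + t *\<^sub>R v)) has_vector_derivative d) (at (0::real))"
  shows "((\<lambda>t. f (y + t *\<^sub>R v)) has_vector_derivative d) (at r)"
proof -
  have "(((\<lambda>t. f ((y + r *\<^sub>R v) + t *\<^sub>R v)) \<circ> (\<lambda>t. t - r)) has_vector_derivative 1 *\<^sub>R d) (at r)"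
    by (rule vector_diff_chain_at) (use assms in \<open>auto intro!: derivative_eq_intros\<close>)
  moreover have "((\<lambda>t. f ((y + r *\<^sub>R v) + t *\<^sub>R v)) \<circ> (\<lambda>t. t - r)) = (\<lambda>t. f (y + t *\<^sub>R v))"
    by (auto simp: fun_eq_iff algebra_simps)
  ultimately show ?thesis by simp
qed

text \<open>
  Moving along the coordinates of \<open>B\<close> one at a time, each step is estimated by the mean value
  inequality with a partial derivative close to its value at \<open>x\<close>. The base point \<open>y\<close> varies
  near \<open>x\<close> because the steps after the first one do not start at \<open>x\<close>.
\<close>

lemma partials_uniform_increment:
  fixes f :: "'a::euclidean_space \<Rightarrow> 'b::real_normed_vector"
  assumes S: "open S" "x \<in> S"
    and der: "\<And>b y. b \<in> Basis \<Longrightarrow> y \<in> S \<Longrightarrow>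
      ((\<lambda>t. f (y + t *\<^sub>R b)) has_vector_derivative D b y) (at (0::real))"
    and cont: "\<And>b. b \<in> Basis \<Longrightarrow> continuous_on S (D b)"
    and B: "finite B" "B \<subseteq> Basis" and "0 < e"
  shows "\<exists>d>0. \<forall>y h. norm (y - x) < d \<longrightarrow> norm h < d \<longrightarrow>
    norm (f (y + (\<Sum>b\<in>B. (h \<bullet> b) *\<^sub>R b)) - f y - (\<Sum>b\<in>B. (h \<bullet> b) *\<^sub>R D b x)) \<le> e * norm h"
  using B \<open>0 < e\<close>
proof (induction B arbitrary: e rule: finite_induct)
  case empty
  then show ?case by (auto intro!: exI[of _ 1])
next
  case (insert c B)
  have c: "c \<in> Basis" using insert by auto
  obtain d1 where d1: "d1 > 0" "\<And>y h. norm (y - x) < d1 \<Longrightarrow> norm h < d1 \<Longrightarrow>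
    norm (f (y + (\<Sum>b\<in>B. (h \<bullet> b) *\<^sub>R b)) - f y - (\<Sum>b\<in>B. (h \<bullet> b) *\<^sub>R D b x)) \<le> e/2 * norm h"
  proof -
    from insert.prems have "B \<subseteq> Basis" "0 < e/2" by auto
    from insert.IH[OF this] show ?thesis using that by blast
  qed
  obtain d2 where d2: "d2 > 0" "ball x d2 \<subseteq> S"
    using S open_contains_ball by blast
  have "\<exists>d>0. \<forall>y\<in>S. dist y x < d \<longrightarrow> dist (D c y) (D c x) < e/2"
    using cont[OF c, unfolded continuous_on_iff, rule_format, OF S(2), of "e/2"] insert.prems by simp
  then obtain d3 where d3: "d3 > 0" "\<And>y. y \<in> S \<Longrightarrow> dist y x < d3 \<Longrightarrow> dist (D c y) (D c x) < e/2"
    by blast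
  \<comment> \<open>The points met below are within \<open>card B * d\<close> of \<open>y\<close>, plus \<open>d\<close> for \<open>y - x\<close> and \<open>d\<close> for the last step.\<close>
  define n where "n = real (card B) + 2"
  have n: "n \<ge> 2" by (simp add: n_def)
  define d where "d = min d1 (min d2 d3 / n)"
  have d: "d > 0" "d \<le> d1" "n * d \<le> min d2 d3"
  proof -
    show "d > 0" "d \<le> d1" using d1 d2 d3 n by (auto simp: d_def)
    have "d \<le> min d2 d3 / n" by (simp add: d_def)
    then show "n * d \<le> min d2 d3" using n by (simp add: field_simps)
  qed
  show ?case
  proof (intro exI[of _ d] conjI allI impI)
    show "d > 0" by fact
    fix y h :: 'a assume y: "norm (y - x) < d" and h: "norm h < d"
    define z where "z = y + (\<Sum>b\<in>B. (h \<bullet> b) *\<^sub>R b)"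
    define a where "a = h \<bullet> c"
    have a: "\<bar>a\<bar> \<le> norm h" unfolding a_def using Basis_le_norm[OF c] .
    have "norm (\<Sum>b\<in>B. (h \<bullet> b) *\<^sub>R b) \<le> (\<Sum>b\<in>B. norm h)"
      using insert.prems by (intro sum_norm_le) (auto intro!: Basis_le_norm)
    then have zb: "norm (z - y) \<le> card B * norm h" by (simp add: z_def)
    have near: "z + t *\<^sub>R c \<in> S \<and> dist (z + t *\<^sub>R c) x < d3" if t: "t \<in> closed_segment 0 a" for t
    proof -
      have t': "\<bar>t\<bar> \<le> \<bar>a\<bar>" using t by (auto simp: closed_segment_eq_real_ivl split: if_splits)
      have "norm (z + t *\<^sub>R c - x) \<le> norm (z - y) + norm (y - x) + norm (t *\<^sub>R c)"
      proof -
        have "z + t *\<^sub>R c - x = ((z - y) + (y - x)) + t *\<^sub>R c" by simp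
        also have "norm \<dots> \<le> norm (z - y) + norm (y - x) + norm (t *\<^sub>R c)"
          by (intro norm_triangle_mono norm_triangle_ineq order_refl)
        finally show ?thesis .
      qed
      also have "\<dots> < card B * norm h + d + norm h"
      proof -
        have "norm (t *\<^sub>R c) \<le> norm h" using t' a c by simp
        then show ?thesis using zb y by linarith
      qed
      also have "\<dots> \<le> card B * d + d + d"
        using h by (intro add_mono mult_left_mono) auto
      also have "\<dots> = n * d" by (simp add: n_def algebra_simps)
      finally have "dist (z + t *\<^sub>R c) x < min d2 d3" using d by (simp add: dist_norm)
      then show ?thesis using d2 by (auto simp: dist_commute)
    qed
    have "norm (f (z + a *\<^sub>R c) - f (z + 0 *\<^sub>R c) - a *\<^sub>R D c x) \<le> e/2 * \<bar>a\<bar>"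
    proof (rule increment_bound)
      fix t assume t: "t \<in> closed_segment 0 a"
      show "((\<lambda>t. f (z + t *\<^sub>R c)) has_vector_derivative D c (z + t *\<^sub>R c)) (at t)"
        using near[OF t] by (blast intro: directional_shift[OF der[OF c]])
      show "norm (D c (z + t *\<^sub>R c) - D c x) \<le> e/2"
        using d3(2)[of "z + t *\<^sub>R c"] near[OF t] by (auto simp: dist_norm)
    qed
    also have "\<dots> \<le> e/2 * norm h" using a \<open>0 < e\<close> insert.prems by (intro mult_left_mono) auto
    finally have 1: "norm (f (z + a *\<^sub>R c) - f z - a *\<^sub>R D c x) \<le> e/2 * norm h" by simp
    have 2: "norm (f z - f y - (\<Sum>b\<in>B. (h \<bullet> b) *\<^sub>R D b x)) \<le> e/2 * norm h"
      unfolding z_def using y h d by (intro d1) auto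
    have eq: "f (y + (\<Sum>b\<in>insert c B. (h \<bullet> b) *\<^sub>R b)) - f y - (\<Sum>b\<in>insert c B. (h \<bullet> b) *\<^sub>R D b x)
      = (f (z + a *\<^sub>R c) - f z - a *\<^sub>R D c x) + (f z - f y - (\<Sum>b\<in>B. (h \<bullet> b) *\<^sub>R D b x))"
      using insert.hyps by (simp add: z_def a_def algebra_simps)
    show "norm (f (y + (\<Sum>b\<in>insert c B. (h \<bullet> b) *\<^sub>R b)) - f y - (\<Sum>b\<in>insert c B. (h \<bullet> b) *\<^sub>R D b x))
        \<le> e * norm h"
      unfolding eq using norm_triangle_mono[OF 1 2] by (simp add: algebra_simps)
  qed
qed

lemma has_derivative_continuous_partials:
  fixes f :: "'a::euclidean_space \<Rightarrow> 'b::real_normed_vector"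
  assumes S: "open S" "x \<in> S"
    and der: "\<And>b y. b \<in> Basis \<Longrightarrow> y \<in> S \<Longrightarrow>
      ((\<lambda>t. f (y + t *\<^sub>R b)) has_vector_derivative D b y) (at (0::real))"
    and cont: "\<And>b. b \<in> Basis \<Longrightarrow> continuous_on S (D b)"
  shows "(f has_derivative (\<lambda>h. \<Sum>b\<in>Basis. (h \<bullet> b) *\<^sub>R D b x)) (at x)"
  unfolding has_derivative_at_alt
proof (intro conjI allI impI)
  show "bounded_linear (\<lambda>h. \<Sum>b\<in>Basis. (h \<bullet> b) *\<^sub>R D b x)"
    by (intro bounded_linear_sum bounded_linear_scaleR_left[THEN bounded_linear_compose]
        bounded_linear_inner_left)
  fix e :: real assume "e > 0"
  obtain d where d: "d > 0" "\<And>y h. norm (y - x) < d \<Longrightarrow> norm h < d \<Longrightarrow>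
    norm (f (y + (\<Sum>b\<in>Basis. (h \<bullet> b) *\<^sub>R b)) - f y - (\<Sum>b\<in>Basis. (h \<bullet> b) *\<^sub>R D b x)) \<le> e * norm h"
    using partials_uniform_increment[OF S der cont finite_Basis subset_refl \<open>e > 0\<close>] by blast
  show "\<exists>d>0. \<forall>y. norm (y - x) < d \<longrightarrow>
      norm (f y - f x - (\<Sum>b\<in>Basis. ((y - x) \<bullet> b) *\<^sub>R D b x)) \<le> e * norm (y - x)"
  proof (intro exI[of _ d] conjI allI impI)
    fix y assume "norm (y - x) < d"
    then show "norm (f y - f x - (\<Sum>b\<in>Basis. ((y - x) \<bullet> b) *\<^sub>R D b x)) \<le> e * norm (y - x)"
      using d(1) d(2)[of x "y - x"] by (simp add: euclidean_representation)
  qed (rule d)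
qed

lemma has_vector_derivative_along_line:
  assumes "(f has_derivative f') (at (x + r *\<^sub>R v))"
  shows "((\<lambda>t. f (x + t *\<^sub>R v)) has_vector_derivative f' v) (at r)"
proof -
  have "((\<lambda>t. x + t *\<^sub>R v) has_vector_derivative v) (at r)"
    by (auto intro!: derivative_eq_intros)
  from vector_derivative_diff_chain_within[OF this, of f f'] assms
  show ?thesis by (simp add: o_def has_derivative_at_withinI)
qed

text \<open>
  Continuous partial derivatives imply Frechet differentiability, and the directional derivatives
  supplied by \<open>Ck_on\<close> are then the values of the Frechet derivative.
\<close>

lemma Ck_on_Suc_has_derivative:
  fixes f :: "'a::euclidean_space \<Rightarrow> 'b::real_normed_vector"
  assumes S: "open S" and f: "Ck_on (Suc k) UNIV S f"
  obtains f' where "\<And>x. x \<in> S \<Longrightarrow> (f has_derivative f' x) (at x)"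
    and "\<And>v. Ck_on k UNIV S (\<lambda>x. f' x v)"
proof -
  from f have "\<forall>v. \<exists>f'. (\<forall>x\<in>S. ((\<lambda>t::real. f (x + t *\<^sub>R v)) has_vector_derivative f' x) (at 0))
                 \<and> Ck_on k UNIV S f'" by simp
  then obtain D where D: "\<And>v x. x \<in> S \<Longrightarrow> ((\<lambda>t::real. f (x + t *\<^sub>R v)) has_vector_derivative D v x) (at 0)"
    "\<And>v. Ck_on k UNIV S (D v)" by metis
  have cont: "continuous_on S (D v)" for v
    using D(2)[of v] by (cases k) auto
  show ?thesis
  proof (rule that)
    fix x assume x: "x \<in> S"
    let ?f' = "\<lambda>h. \<Sum>b\<in>Basis. (h \<bullet> b) *\<^sub>R D b x"
    have der: "(f has_derivative ?f') (at x)"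
      by (rule has_derivative_continuous_partials[OF S x D(1) cont])
    have "?f' v = D v x" for v
    proof -
      have "((\<lambda>t. f (x + t *\<^sub>R v)) has_vector_derivative ?f' v) (at 0)"
        by (rule has_vector_derivative_along_line) (use der in simp)
      from vector_derivative_unique_at[OF this D(1)[OF x]] show ?thesis .
    qed
    then have "?f' = (\<lambda>v. D v x)" by (rule ext)
    with der show "(f has_derivative (\<lambda>v. D v x)) (at x)" by simp
  next
    show "Ck_on k UNIV S (\<lambda>x. D v x)" for v using D(2)[of v] by simp
  qed
qed

lemma smooth_on_differentiable:
  fixes f :: "'a::euclidean_space \<Rightarrow> 'b::real_normed_vector"
  assumes S: "open S" and f: "smooth_on UNIV S f" and x: "x \<in> S"
  shows "(f has_derivative frechet_derivative f (at x)) (at x)"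
    and "((\<lambda>z. frechet_derivative f (at z) w) has_derivative
           frechet_derivative (\<lambda>z. frechet_derivative f (at z) w) (at x)) (at x)"
proof -
  have "Ck_on (Suc (Suc 0)) UNIV S f" using f by (simp only: smooth_on_def)
  from Ck_on_Suc_has_derivative[OF S this]
  obtain f' where f': "\<And>x. x \<in> S \<Longrightarrow> (f has_derivative f' x) (at x)"
    and "\<And>v. Ck_on (Suc 0) UNIV S (\<lambda>x. f' x v)" by metis
  from Ck_on_Suc_has_derivative[OF S this(2)]
  obtain f'' where f'': "((\<lambda>x. f' x w) has_derivative f'') (at x)" using x by metis
  have eq: "frechet_derivative f (at z) = f' z" if "z \<in> S" for z
    using frechet_derivative_at[OF f'[OF that]] by simp
  show "(f has_derivative frechet_derivative f (at x)) (at x)" using eq f' x by simp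
  have "((\<lambda>z. frechet_derivative f (at z) w) has_derivative f'') (at x)"
    by (rule has_derivative_transform_within_open[OF f'' S x]) (simp add: eq)
  then show "((\<lambda>z. frechet_derivative f (at z) w) has_derivative
           frechet_derivative (\<lambda>z. frechet_derivative f (at z) w) (at x)) (at x)"
    using frechet_derivative_works differentiable_def by blast
qed

text \<open>
  With \<open>L\<close> a projection onto \<open>V\<close>, this turns a smooth function on a relatively open subset of \<open>V\<close>
  into one on an open subset of the ambient space, where the Frechet derivative is unique.
\<close>

lemma Ck_on_compose_linear:
  assumes L: "bounded_linear L" and range: "range L \<subseteq> V"
  shows "Ck_on k V S f \<Longrightarrow> Ck_on k UNIV (L -` S) (f \<circ> L)"
proof (induction k arbitrary: f)
  case 0
  then have "continuous_on S f" by simp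
  then have "continuous_on (L -` S) (f \<circ> L)"
    by (intro continuous_on_compose linear_continuous_on[OF L]) (rule continuous_on_subset, auto)
  then show ?case by simp
next
  case (Suc k)
  interpret bounded_linear L by fact
  have "continuous_on S f" using Suc.prems by simp
  then have "continuous_on (L -` S) (f \<circ> L)"
    by (intro continuous_on_compose linear_continuous_on[OF L]) (rule continuous_on_subset, auto)
  moreover have "\<exists>f'. (\<forall>x\<in>L -` S. ((\<lambda>t::real. (f \<circ> L) (x + t *\<^sub>R v)) has_vector_derivative f' x) (at 0))
                 \<and> Ck_on k UNIV (L -` S) f'" for v
  proof -
    have "L v \<in> V" using range by auto
    then obtain f' where "\<forall>x\<in>S. ((\<lambda>t::real. f (x + t *\<^sub>R L v)) has_vector_derivative f' x) (at 0)"
      "Ck_on k V S f'" using Suc.prems by auto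
    then show ?thesis by (intro exI[of _ "f' \<circ> L"]) (auto simp: add scaleR intro: Suc.IH)
  qed
  ultimately show ?case by simp
qed

text \<open>
  The second difference \<open>f (p + h u + h v) - f (p + h u) - f (p + h v) + f p\<close> is symmetric in \<open>u\<close> and
  \<open>v\<close>. By the mean value inequality in the direction \<open>u\<close> it equals \<open>h\<^sup>2 Lu v\<close> up to \<open>o(h\<^sup>2)\<close>, hence by
  symmetry also \<open>h\<^sup>2 Lv u\<close>.
\<close>

lemma symmetric_second_derivative:
  fixes f :: "'a::real_normed_vector \<Rightarrow> 'b::real_normed_vector"
  assumes S: "open S" "p \<in> S"
    and f': "\<And>x. x \<in> S \<Longrightarrow> (f has_derivative f' x) (at x)"
    and u: "((\<lambda>x. f' x u) has_derivative Lu) (at p)"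
    and v: "((\<lambda>x. f' x v) has_derivative Lv) (at p)"
  shows "Lu v = Lv u"
proof -
  define Q where "Q h = f (p + h *\<^sub>R u + h *\<^sub>R v) - f (p + h *\<^sub>R u) - f (p + h *\<^sub>R v) + f p" for h :: real
  have main: "\<exists>d>0. \<forall>h. 0 < h \<and> h < d \<longrightarrow>
      norm (f (p + h *\<^sub>R u + h *\<^sub>R v) - f (p + h *\<^sub>R u) - f (p + h *\<^sub>R v) + f p - (h * h) *\<^sub>R Lu v) \<le> e * (h * h)"
    if u: "((\<lambda>x. f' x u) has_derivative Lu) (at p)" and "e > 0" for u v Lu and e :: real
  proof -
    \<comment> \<open>Both points at which \<open>f'\<close> is linearised are within \<open>h * (norm u + norm v)\<close> of \<open>p\<close>; adding \<open>1\<close> makes \<open>K\<close> positive.\<close>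
    define K where "K = 2 * (norm u + norm v) + 1"
    have K: "K > 0" by (simp add: K_def add_pos_nonneg add_nonneg_pos)
    interpret bounded_linear Lu using u by (rule has_derivative_bounded_linear)
    from u \<open>e > 0\<close> K obtain d1 where d1: "d1 > 0" "\<And>y. norm (y - p) < d1 \<Longrightarrow>
       norm (f' y u - f' p u - Lu (y - p)) \<le> e / K * norm (y - p)"
      unfolding has_derivative_at_alt by (meson divide_pos_pos)
    obtain d2 where d2: "d2 > 0" "ball p d2 \<subseteq> S" using S open_contains_ball by blast
    define d where "d = min d1 d2 / K"
    have d: "d > 0" "d * K = min d1 d2" using d1 d2 K by (auto simp: d_def)
    show ?thesis
    proof (intro exI[of _ d] conjI allI impI)
      show "d > 0" by fact
      fix h assume h: "0 < h \<and> h < d"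
      have small: "norm w < min d1 d2" if "norm w \<le> h * (norm u + norm v)" for w :: 'a
      proof -
        have "h * (norm u + norm v) \<le> h * K" using h by (intro mult_left_mono) (auto simp: K_def)
        also have "\<dots> < d * K" using h K by simp
        finally show ?thesis using that d by simp
      qed
      define g where "g s = f ((p + h *\<^sub>R v) + s *\<^sub>R u) - f (p + s *\<^sub>R u)" for s
      have "norm (g h - g 0 - h *\<^sub>R (h *\<^sub>R Lu v)) \<le> (e * h) * \<bar>h\<bar>"
      proof (rule increment_bound)
        fix s assume "s \<in> closed_segment 0 h"
        then have s: "0 \<le> s" "s \<le> h" using h by (auto simp: closed_segment_eq_real_ivl)
        have su: "s * norm u \<le> h * norm u" using s by (intro mult_right_mono) auto
        have n1: "norm (h *\<^sub>R v + s *\<^sub>R u) \<le> h * (norm u + norm v)"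
          using norm_triangle_ineq[of "h *\<^sub>R v" "s *\<^sub>R u"] s h su by (simp add: algebra_simps)
        have n2: "norm (s *\<^sub>R u) \<le> h * (norm u + norm v)"
          using s h su by (simp add: algebra_simps add_increasing2)
        have S1: "(p + h *\<^sub>R v) + s *\<^sub>R u \<in> S" "p + s *\<^sub>R u \<in> S"
          using small[OF n1] small[OF n2] d2(2) by (auto simp: dist_norm subset_iff norm_minus_commute algebra_simps)
        show "(g has_vector_derivative f' ((p + h *\<^sub>R v) + s *\<^sub>R u) u - f' (p + s *\<^sub>R u) u) (at s)"
          unfolding g_def by (intro has_vector_derivative_diff has_vector_derivative_along_line f' S1)
        have 1: "norm (f' ((p + h *\<^sub>R v) + s *\<^sub>R u) u - f' p u - Lu (h *\<^sub>R v + s *\<^sub>R u)) \<le> e / K * (h * (norm u + norm v))"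
        proof -
          have "(p + h *\<^sub>R v) + s *\<^sub>R u - p = h *\<^sub>R v + s *\<^sub>R u" by simp
          then have "norm (f' ((p + h *\<^sub>R v) + s *\<^sub>R u) u - f' p u - Lu (h *\<^sub>R v + s *\<^sub>R u))
              \<le> e / K * norm (h *\<^sub>R v + s *\<^sub>R u)"
            using d1(2)[of "(p + h *\<^sub>R v) + s *\<^sub>R u"] small[OF n1] by simp
          also have "\<dots> \<le> e / K * (h * (norm u + norm v))"
            using \<open>e > 0\<close> K by (intro mult_left_mono n1) auto
          finally show ?thesis .
        qed
        have 2: "norm (f' (p + s *\<^sub>R u) u - f' p u - Lu (s *\<^sub>R u)) \<le> e / K * (h * (norm u + norm v))"
        proof -
          have "norm (f' (p + s *\<^sub>R u) u - f' p u - Lu (s *\<^sub>R u)) \<le> e / K * norm (s *\<^sub>R u)"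
            using d1(2)[of "p + s *\<^sub>R u"] small[OF n2] by simp
          also have "\<dots> \<le> e / K * (h * (norm u + norm v))"
            using \<open>e > 0\<close> K by (intro mult_left_mono n2) auto
          finally show ?thesis .
        qed
        have "f' ((p + h *\<^sub>R v) + s *\<^sub>R u) u - f' (p + s *\<^sub>R u) u - h *\<^sub>R Lu v =
          (f' ((p + h *\<^sub>R v) + s *\<^sub>R u) u - f' p u - Lu (h *\<^sub>R v + s *\<^sub>R u)) - (f' (p + s *\<^sub>R u) u - f' p u - Lu (s *\<^sub>R u))"
          by (simp add: add scaleR algebra_simps)
        also have "norm \<dots> \<le> e / K * (h * (norm u + norm v)) + e / K * (h * (norm u + norm v))"
          by (rule order_trans[OF norm_triangle_ineq4 add_mono[OF 1 2]])
        also have "\<dots> = e * h * (2 * (norm u + norm v) / K)" by (simp add: field_simps)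
        also have "\<dots> \<le> e * h * 1" using K h \<open>e > 0\<close> by (intro mult_left_mono) (auto simp: K_def divide_le_eq)
        finally show "norm (f' ((p + h *\<^sub>R v) + s *\<^sub>R u) u - f' (p + s *\<^sub>R u) u - h *\<^sub>R Lu v) \<le> e * h" by simp
      qed
      moreover have "g h - g 0 - h *\<^sub>R (h *\<^sub>R Lu v) =
        f (p + h *\<^sub>R u + h *\<^sub>R v) - f (p + h *\<^sub>R u) - f (p + h *\<^sub>R v) + f p - (h * h) *\<^sub>R Lu v"
        by (simp add: g_def algebra_simps)
      ultimately show "norm (f (p + h *\<^sub>R u + h *\<^sub>R v) - f (p + h *\<^sub>R u) - f (p + h *\<^sub>R v) + f p - (h * h) *\<^sub>R Lu v)
         \<le> e * (h * h)" using h by (simp add: mult.assoc)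
    qed
  qed
  have "norm (Lu v - Lv u) \<le> e" if "e > 0" for e
  proof -
    obtain d1 where d1: "d1 > 0" "\<And>h. 0 < h \<Longrightarrow> h < d1 \<Longrightarrow> norm (Q h - (h * h) *\<^sub>R Lu v) \<le> e/2 * (h * h)"
      using main[OF u, of "e/2" v] \<open>e > 0\<close> unfolding Q_def by auto
    obtain d2 where d2: "d2 > 0" "\<And>h. 0 < h \<Longrightarrow> h < d2 \<Longrightarrow> norm (Q h - (h * h) *\<^sub>R Lv u) \<le> e/2 * (h * h)"
      using main[OF v, of "e/2" u] \<open>e > 0\<close> unfolding Q_def by (auto simp: algebra_simps)
    define h where "h = min d1 d2 / 2"
    have h: "0 < h" "h < d1" "h < d2" using d1 d2 by (auto simp: h_def)
    have "norm ((Q h - (h * h) *\<^sub>R Lv u) - (Q h - (h * h) *\<^sub>R Lu v)) \<le> e/2 * (h * h) + e/2 * (h * h)"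
      by (rule order_trans[OF norm_triangle_ineq4 add_mono[OF d2(2)[OF h(1,3)] d1(2)[OF h(1,2)]]])
    also have "(Q h - (h * h) *\<^sub>R Lv u) - (Q h - (h * h) *\<^sub>R Lu v) = (h * h) *\<^sub>R (Lu v - Lv u)"
      by (simp add: algebra_simps)
    finally have "(h * h) * norm (Lu v - Lv u) \<le> (h * h) * e" by (simp add: mult.commute)
    then show ?thesis using h by (simp add: mult_le_cancel_left)
  qed
  then have "norm (Lu v - Lv u) \<le> 0" by (meson field_le_epsilon add_0 dual_order.refl le_add_same_cancel2 order_trans)
  then show ?thesis by simp
qed

text \<open>
  A product rule for a linear map and its argument that both depend on \<open>x\<close>. The dependence of \<open>D\<close> on
  its base point is assumed differentiable only for each fixed argument; expanding the argument in
  the finite basis reduces the claim to finitely many such arguments.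
\<close>

lemma has_derivative_linear_family:
  fixes D :: "'a::real_normed_vector \<Rightarrow> 'b::euclidean_space \<Rightarrow> 'c::real_normed_vector"
  assumes z: "(z has_derivative z') (at p)" and w: "(w has_derivative w') (at p)"
    and W: "open W" "z p \<in> W" and lin: "\<And>y. y \<in> W \<Longrightarrow> linear (D y)"
    and D2: "\<And>b. ((\<lambda>y. D y b) has_derivative D2 b) (at (z p))"
  shows "((\<lambda>x. D (z x) (w x)) has_derivative (\<lambda>h. D2 (w p) (z' h) + D (z p) (w' h))) (at p)"
proof -
  have expand: "(\<Sum>b\<in>Basis. (v \<bullet> b) *\<^sub>R D y b) = D y v" if "y \<in> W" for y v
  proof -
    interpret linear "D y" using lin[OF that] .
    have "D y v = D y (\<Sum>b\<in>Basis. (v \<bullet> b) *\<^sub>R b)" by (simp add: euclidean_representation)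
    also have "\<dots> = (\<Sum>b\<in>Basis. (v \<bullet> b) *\<^sub>R D y b)" by (simp add: sum scale)
    finally show ?thesis by simp
  qed
  have "((\<lambda>y. \<Sum>b\<in>Basis. (w p \<bullet> b) *\<^sub>R D y b) has_derivative (\<lambda>h. \<Sum>b\<in>Basis. (w p \<bullet> b) *\<^sub>R D2 b h)) (at (z p))"
    by (intro has_derivative_sum has_derivative_scaleR_right D2)
  then have "((\<lambda>y. D y (w p)) has_derivative (\<lambda>h. \<Sum>b\<in>Basis. (w p \<bullet> b) *\<^sub>R D2 b h)) (at (z p))"
    by (rule has_derivative_transform_within_open[OF _ W]) (simp add: expand)
  from has_derivative_unique[OF D2 this]
  have D2w: "D2 (w p) h = (\<Sum>b\<in>Basis. (w p \<bullet> b) *\<^sub>R D2 b h)" for h by metis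
  have Dz: "((\<lambda>x. D (z x) b) has_derivative (\<lambda>h. D2 b (z' h))) (at p)" for b
    using diff_chain_at[OF z D2] by (simp add: o_def)
  have "((\<lambda>x. \<Sum>b\<in>Basis. (w x \<bullet> b) *\<^sub>R D (z x) b) has_derivative
     (\<lambda>h. \<Sum>b\<in>Basis. (w p \<bullet> b) *\<^sub>R D2 b (z' h) + (w' h \<bullet> b) *\<^sub>R D (z p) b)) (at p)"
    by (intro has_derivative_sum has_derivative_scaleR Dz has_derivative_inner_left w)
  moreover have "(\<lambda>h. \<Sum>b\<in>Basis. (w p \<bullet> b) *\<^sub>R D2 b (z' h) + (w' h \<bullet> b) *\<^sub>R D (z p) b)
     = (\<lambda>h. D2 (w p) (z' h) + D (z p) (w' h))"
    by (simp add: sum.distrib D2w expand W)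
  moreover have "\<forall>\<^sub>F x in at p. z x \<in> W"
    using has_derivative_continuous[OF z] W by (auto simp: continuous_within intro: topological_tendstoD)
  then have "\<forall>\<^sub>F x in at p. (\<Sum>b\<in>Basis. (w x \<bullet> b) *\<^sub>R D (z x) b) = D (z x) (w x)"
    by eventually_elim (simp add: expand)
  ultimately show ?thesis
    using has_derivative_transform_eventually[of "\<lambda>x. \<Sum>b\<in>Basis. (w x \<bullet> b) *\<^sub>R D (z x) b" _ p UNIV "\<lambda>x. D (z x) (w x)"]
    by (simp add: expand W)
qed

lemma has_vector_derivative_in_subspace:
  fixes f :: "real \<Rightarrow> 'a::euclidean_space"
  assumes "(f has_vector_derivative d) (at 0)" "subspace V" "f 0 \<in> V" "\<forall>\<^sub>F t in at 0. f t \<in> V"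
  shows "d \<in> V"
proof (rule Lim_in_closed_set[OF closed_subspace[OF \<open>subspace V\<close>], of _ "at (0::real)"])
  have "((\<lambda>t. (f t - f 0 - t *\<^sub>R d) /\<^sub>R norm t) \<longlongrightarrow> 0) (at 0)"
    using assms(1) by (simp add: has_vector_derivative_def has_derivative_at_within)
  then have "((\<lambda>t. norm ((f t - f 0 - t *\<^sub>R d) /\<^sub>R norm t)) \<longlongrightarrow> 0) (at 0)"
    by (rule tendsto_norm_zero)
  moreover have "\<forall>\<^sub>F t in at 0. norm ((f t - f 0 - t *\<^sub>R d) /\<^sub>R norm t) = norm ((f t - f 0) /\<^sub>R t - d)"
    using eventually_neq_at_within[of 0]
  proof eventually_elim
    case (elim t)
    then have "(f t - f 0) /\<^sub>R t - d = (f t - f 0 - t *\<^sub>R d) /\<^sub>R t" by (simp add: algebra_simps)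
    then show ?case by simp
  qed
  ultimately have "((\<lambda>t. norm ((f t - f 0) /\<^sub>R t - d)) \<longlongrightarrow> 0) (at 0)"
    using tendsto_cong by fast
  then show "((\<lambda>t. (f t - f 0) /\<^sub>R t) \<longlongrightarrow> d) (at 0)"
    by (rule LIM_zero_cancel[OF tendsto_norm_zero_cancel])
  show "\<forall>\<^sub>F t in at 0. (f t - f 0) /\<^sub>R t \<in> V"
    using assms(4) by eventually_elim (use assms in \<open>auto intro!: subspace_mul subspace_diff\<close>)
qed auto

lemma exists_projection_onto_subspace:
  fixes E :: "'a::euclidean_space set"
  assumes "subspace E"
  shows "\<exists>P. bounded_linear P \<and> range P \<subseteq> E \<and> (\<forall>x\<in>E. P x = x)"
  using linear_exists_left_inverse_on[OF linear_id assms, simplified] by (auto intro: linear_conv_bounded_linear[THEN iffD1])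

lemma smooth_on_compose_linear:
  assumes "bounded_linear L" "range L \<subseteq> V" "smooth_on V S f"
  shows "smooth_on UNIV (L -` S) (f \<circ> L)"
  using assms by (simp add: smooth_on_def Ck_on_compose_linear)

section \<open>The Lie bracket in a chart around the identity\<close>

locale lie_group_chart = lie_group G
  for G :: "('g, 'e::euclidean_space, 'z) lie_group_data_scheme" (structure) +
  fixes \<kappa> :: "('g, 'e) chart"
  assumes chart_at_one: "chart_at_one G \<kappa>"
begin

abbreviation U :: "'g set" where "U \<equiv> fst \<kappa>"
abbreviation \<phi> :: "'g \<Rightarrow> 'e" where "\<phi> \<equiv> snd \<kappa>"
abbreviation \<psi> :: "'e \<Rightarrow> 'g" where "\<psi> \<equiv> chart_inv \<kappa>"
abbreviation E :: "'e set" where "E \<equiv> model G"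
abbreviation e0 :: 'e where "e0 \<equiv> \<phi> \<one>"

lemma one_in_U: "\<one> \<in> U" and chart_in_atlas: "(U, \<phi>) \<in> atlas G"
  using chart_at_one by (auto simp: chart_at_one_def)

lemma openin_U: "openin (gtop G) U"
  and openin_image: "openin (top_of_set E) (\<phi> ` U)"
  and homeomorphic_chart: "homeomorphic_map (subtopology (gtop G) U) (top_of_set (\<phi> ` U)) \<phi>"
  using atlas chart_in_atlas unfolding smooth_atlas_def by fastforce+

lemma U_subset: "U \<subseteq> carrier G"
  using openin_subset[OF openin_U] topspace_gtop by simp

lemma image_subset_model: "\<phi> ` U \<subseteq> E"
  using openin_subset[OF openin_image] by simp

lemma inj_chart: "inj_on \<phi> U"
  using homeomorphic_imp_injective_map[OF homeomorphic_chart] U_subset topspace_gtop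
  by (simp add: Int_absorb1)

lemma \<psi>_\<phi> [simp]: "p \<in> U \<Longrightarrow> \<psi> (\<phi> p) = p"
  by (simp add: chart_inv_def inj_chart)

lemma \<phi>_\<psi> [simp]: "x \<in> \<phi> ` U \<Longrightarrow> \<phi> (\<psi> x) = x"
  by (simp add: chart_inv_def f_inv_into_f)

lemma \<psi>_in_U: "x \<in> \<phi> ` U \<Longrightarrow> \<psi> x \<in> U"
  by (simp add: chart_inv_def inv_into_into)

lemma \<psi>_in_carrier: "x \<in> \<phi> ` U \<Longrightarrow> \<psi> x \<in> carrier G"
  using \<psi>_in_U U_subset by blast

lemma e0_in_image: "e0 \<in> \<phi> ` U" and e0_in_model: "e0 \<in> E"
  using one_in_U image_subset_model by auto

lemma \<psi>_e0 [simp]: "\<psi> e0 = \<one>"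
  by (simp add: one_in_U)

lemma continuous_chart_inv: "continuous_map (top_of_set (\<phi> ` U)) (gtop G) \<psi>"
proof -
  obtain g where g: "homeomorphic_maps (subtopology (gtop G) U) (top_of_set (\<phi> ` U)) \<phi> g"
    using homeomorphic_chart homeomorphic_map_maps by blast
  have "continuous_map (top_of_set (\<phi> ` U)) (subtopology (gtop G) U) g"
    using g by (simp add: homeomorphic_maps_def)
  then have "continuous_map (top_of_set (\<phi> ` U)) (gtop G) g"
    using continuous_map_into_fulltopology by blast
  moreover have "g x = \<psi> x" if "x \<in> topspace (top_of_set (\<phi> ` U))" for x
    using that g one_in_U U_subset topspace_gtop
    by (auto simp: homeomorphic_maps_def)
  ultimately show ?thesis using continuous_map_eq by blast
qed

definition mult_dom :: "('e \<times> 'e) set" where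
  "mult_dom = {(x, y). x \<in> \<phi> ` U \<and> y \<in> \<phi> ` U \<and> \<psi> x \<otimes> \<psi> y \<in> U}"

definition inv_dom :: "'e set" where
  "inv_dom = {x \<in> \<phi> ` U. inv (\<psi> x) \<in> U}"

lemma openin_mult_dom: "openin (top_of_set (E \<times> E)) mult_dom"
proof -
  let ?X = "top_of_set (\<phi> ` U \<times> \<phi> ` U)"
  have "continuous_map ?X (top_of_set (\<phi> ` U)) fst" "continuous_map ?X (top_of_set (\<phi> ` U)) snd"
    by (auto intro: continuous_intros)
  from this[THEN continuous_map_compose, OF continuous_chart_inv]
  have "continuous_map ?X (prod_topology (gtop G) (gtop G)) (\<lambda>z. (\<psi> (fst z), \<psi> (snd z)))"
    by (simp add: continuous_map_pairwise o_def)
  from continuous_map_compose[OF this continuous_mult]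
  have "continuous_map ?X (gtop G) (\<lambda>z. \<psi> (fst z) \<otimes> \<psi> (snd z))" by (simp add: o_def)
  from openin_continuous_map_preimage[OF this openin_U]
  have "openin ?X {z \<in> \<phi> ` U \<times> \<phi> ` U. \<psi> (fst z) \<otimes> \<psi> (snd z) \<in> U}" by simp
  also have "{z \<in> \<phi> ` U \<times> \<phi> ` U. \<psi> (fst z) \<otimes> \<psi> (snd z) \<in> U} = mult_dom"
    by (auto simp: mult_dom_def)
  finally show ?thesis
    using openin_trans openin_Times[OF openin_image openin_image] by blast
qed

lemma openin_inv_dom: "openin (top_of_set E) inv_dom"
proof -
  have "continuous_map (top_of_set (\<phi> ` U)) (gtop G) (\<lambda>x. inv (\<psi> x))"
    using continuous_map_compose[OF continuous_chart_inv continuous_inv] by (simp add: o_def)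
  from openin_continuous_map_preimage[OF this openin_U]
  have "openin (top_of_set (\<phi> ` U)) inv_dom" by (simp add: inv_dom_def)
  then show ?thesis using openin_trans openin_image by blast
qed

text \<open>
  The chart takes values in a subspace. Composing with a linear projection onto it extends the
  coordinate expressions of the group operations to open sets of the ambient space.
\<close>

definition proj :: "'e \<Rightarrow> 'e" where
  "proj = (SOME P. bounded_linear P \<and> range P \<subseteq> E \<and> (\<forall>x\<in>E. P x = x))"

lemma bounded_linear_proj: "bounded_linear proj"
  and proj_in_model: "proj x \<in> E"
  and proj_id [simp]: "x \<in> E \<Longrightarrow> proj x = x"
  using someI_ex[OF exists_projection_onto_subspace[OF subspace_model]] unfolding proj_def by auto

definition proj2 :: "'e \<times> 'e \<Rightarrow> 'e \<times> 'e" where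
  "proj2 z = (proj (fst z), proj (snd z))"

lemma bounded_linear_proj2: "bounded_linear proj2"
  unfolding proj2_def [abs_def]
  by (intro bounded_linear_Pair bounded_linear_compose[OF bounded_linear_proj]
      bounded_linear_fst bounded_linear_snd)

definition cmul :: "'e \<times> 'e \<Rightarrow> 'e" where
  "cmul z = \<phi> (\<psi> (proj (fst z)) \<otimes> \<psi> (proj (snd z)))"

definition cinv :: "'e \<Rightarrow> 'e" where
  "cinv x = \<phi> (inv (\<psi> (proj x)))"

definition mult_dom_ext :: "('e \<times> 'e) set" where "mult_dom_ext = proj2 -` mult_dom"
definition inv_dom_ext :: "'e set" where "inv_dom_ext = proj -` inv_dom"

lemma open_mult_dom_ext: "open mult_dom_ext"
proof -
  obtain T where T: "open T" "mult_dom = (E \<times> E) \<inter> T"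
    using openin_mult_dom by (auto simp: openin_open)
  have "mult_dom_ext = proj2 -` T" by (auto simp: mult_dom_ext_def T proj2_def proj_in_model)
  moreover have "open (proj2 -` T)"
    using T linear_continuous_on[OF bounded_linear_proj2, of UNIV] by (metis open_vimage)
  ultimately show ?thesis by simp
qed

lemma open_inv_dom_ext: "open inv_dom_ext"
proof -
  obtain T where T: "open T" "inv_dom = E \<inter> T"
    using openin_inv_dom by (auto simp: openin_open)
  have "inv_dom_ext = proj -` T" by (auto simp: inv_dom_ext_def T proj_in_model)
  moreover have "open (proj -` T)"
    using T linear_continuous_on[OF bounded_linear_proj, of UNIV] by (metis open_vimage)
  ultimately show ?thesis by simp
qed

lemma smooth_cmul: "smooth_on UNIV mult_dom_ext cmul"
proof -
  have "smooth_on (E \<times> E) mult_dom (\<lambda>(x, y). \<phi> (\<psi> x \<otimes> \<psi> y))"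
    using smooth_mult[OF chart_in_atlas chart_in_atlas chart_in_atlas] by (simp add: mult_dom_def)
  then have "smooth_on UNIV mult_dom_ext ((\<lambda>(x, y). \<phi> (\<psi> x \<otimes> \<psi> y)) \<circ> proj2)"
    unfolding mult_dom_ext_def
    by (intro smooth_on_compose_linear[OF bounded_linear_proj2]) (auto simp: proj2_def proj_in_model)
  moreover have "(\<lambda>(x, y). \<phi> (\<psi> x \<otimes> \<psi> y)) \<circ> proj2 = cmul"
    by (auto simp: fun_eq_iff cmul_def proj2_def)
  ultimately show ?thesis by simp
qed

lemma smooth_cinv: "smooth_on UNIV inv_dom_ext cinv"
proof -
  have "smooth_on E inv_dom (\<lambda>x. \<phi> (inv (\<psi> x)))"
    using smooth_inv[OF chart_in_atlas chart_in_atlas] by (simp add: inv_dom_def)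
  then have "smooth_on UNIV inv_dom_ext ((\<lambda>x. \<phi> (inv (\<psi> x))) \<circ> proj)"
    unfolding inv_dom_ext_def
    by (intro smooth_on_compose_linear[OF bounded_linear_proj]) (auto simp: proj_in_model)
  moreover have "(\<lambda>x. \<phi> (inv (\<psi> x))) \<circ> proj = cinv"
    by (auto simp: fun_eq_iff cinv_def)
  ultimately show ?thesis by simp
qed

definition dmul :: "'e \<times> 'e \<Rightarrow> 'e \<times> 'e \<Rightarrow> 'e" where
  "dmul z = frechet_derivative cmul (at z)"

definition ddmul :: "'e \<times> 'e \<Rightarrow> 'e \<times> 'e \<Rightarrow> 'e \<times> 'e \<Rightarrow> 'e" where
  "ddmul z w = frechet_derivative (\<lambda>z. dmul z w) (at z)"

lemma cmul_has_derivative: "z \<in> mult_dom_ext \<Longrightarrow> (cmul has_derivative dmul z) (at z)"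
  and dmul_has_derivative: "z \<in> mult_dom_ext \<Longrightarrow> ((\<lambda>z. dmul z w) has_derivative ddmul z w) (at z)"
  unfolding ddmul_def dmul_def
  by (rule smooth_on_differentiable[OF open_mult_dom_ext smooth_cmul]; assumption)+

lemma linear_dmul: "z \<in> mult_dom_ext \<Longrightarrow> linear (dmul z)"
  using cmul_has_derivative has_derivative_linear by blast

lemma ddmul_symmetric: "z \<in> mult_dom_ext \<Longrightarrow> ddmul z w w' = ddmul z w' w"
  using symmetric_second_derivative[OF open_mult_dom_ext _ cmul_has_derivative dmul_has_derivative dmul_has_derivative] .

text \<open>
  The derivatives of multiplication are evaluated below at the points \<open>(x, e0)\<close>, \<open>(e0, x)\<close> and \<open>(x, cinv x)\<close> with
  \<open>x\<close> in \<open>inv_dom\<close>; at these the product is \<open>x\<close> or the identity, so it lies in the chart.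
\<close>

lemma inv_dom_D:
  assumes "x \<in> inv_dom"
  shows "x \<in> \<phi> ` U" "x \<in> E" "\<psi> x \<in> U" "\<psi> x \<in> carrier G" "inv (\<psi> x) \<in> U"
    "cinv x = \<phi> (inv (\<psi> x))" "cinv x \<in> \<phi> ` U" "cinv x \<in> E" "\<psi> (cinv x) = inv (\<psi> x)"
    "(x, e0) \<in> mult_dom_ext" "(e0, x) \<in> mult_dom_ext" "(x, cinv x) \<in> mult_dom_ext" "x \<in> inv_dom_ext"
proof -
  show a: "x \<in> \<phi> ` U" "inv (\<psi> x) \<in> U" using assms by (auto simp: inv_dom_def)
  show b: "x \<in> E" "\<psi> x \<in> U" "\<psi> x \<in> carrier G"
    using a image_subset_model \<psi>_in_U \<psi>_in_carrier by auto
  show c: "cinv x = \<phi> (inv (\<psi> x))" using b by (simp add: cinv_def)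
  then show d: "cinv x \<in> \<phi> ` U" "cinv x \<in> E" "\<psi> (cinv x) = inv (\<psi> x)"
    using a image_subset_model by auto
  show "(x, e0) \<in> mult_dom_ext" "(e0, x) \<in> mult_dom_ext" "(x, cinv x) \<in> mult_dom_ext" "x \<in> inv_dom_ext"
    using a b d e0_in_image e0_in_model one_in_U assms
    by (auto simp: mult_dom_ext_def inv_dom_ext_def mult_dom_def proj2_def)
qed

lemma e0_in_inv_dom: "e0 \<in> inv_dom"
  using one_in_U by (simp add: inv_dom_def)

lemma cinv_e0 [simp]: "cinv e0 = e0"
  using inv_dom_D(6)[OF e0_in_inv_dom] by simp

lemma mult_dom_ext_D:
  assumes "(x, y) \<in> mult_dom_ext" "x \<in> E" "y \<in> E"
  shows "x \<in> \<phi> ` U" "y \<in> \<phi> ` U" "cmul (x, y) = \<phi> (\<psi> x \<otimes> \<psi> y)"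
    "\<psi> (cmul (x, y)) = \<psi> x \<otimes> \<psi> y" "cmul (x, y) \<in> \<phi> ` U" "cmul (x, y) \<in> E"
  using assms image_subset_model by (auto simp: mult_dom_ext_def mult_dom_def proj2_def cmul_def)

lemma cmul_e0_right: "x \<in> inv_dom \<Longrightarrow> cmul (x, e0) = x"
  by (simp add: cmul_def inv_dom_D e0_in_model)

text \<open>
  The chain rule applied to \<open>y \<mapsto> (x y) x\<inverse>\<close> at the identity: a formula for \<open>Ad\<close> at the group element with
  coordinate \<open>x\<close> from which differentiability in \<open>x\<close> can be read off.
\<close>

definition Ad_coord :: "'e \<Rightarrow> 'e \<Rightarrow> 'e" where
  "Ad_coord v x = dmul (x, cinv x) (dmul (x, e0) (0, v), 0)"

lemma line_in_model: "x \<in> E \<Longrightarrow> v \<in> E \<Longrightarrow> x + t *\<^sub>R v \<in> E"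
  using subspace_model by (simp add: subspace_add subspace_mul)

lemma eventually_in_open_curve:
  assumes "(c has_vector_derivative d) (at (0::real))" "open S" "c 0 \<in> S"
  shows "\<forall>\<^sub>F t in at 0. c t \<in> S"
  using has_vector_derivative_continuous[OF assms(1)] assms(2,3)
  by (auto simp: continuous_within intro: topological_tendstoD)

text \<open>
  \<open>K\<close> is the curve \<open>t \<mapsto> a p(t) a\<inverse>\<close> in coordinates, where \<open>a\<close> has coordinate \<open>x\<close> and \<open>p\<close> is the chart
  line in direction \<open>v\<close>. The last conclusion contains the identity \<open>(a p a\<inverse>) a = a p\<close>.
\<close>

lemma conjugation_in_chart:
  assumes x: "x \<in> inv_dom" and v: "v \<in> E"
  defines "K \<equiv> \<lambda>t. cmul (cmul (x, e0 + t *\<^sub>R v), cinv x)"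
  shows "(K has_vector_derivative Ad_coord v x) (at 0)"
    and "K 0 = e0"
    and "\<phi> (\<psi> x \<otimes> chart_line G \<kappa> v 0 \<otimes> inv (\<psi> x)) = e0"
    and "\<forall>\<^sub>F t in at 0. K t = \<phi> (\<psi> x \<otimes> chart_line G \<kappa> v t \<otimes> inv (\<psi> x))
            \<and> K t \<in> E \<and> cmul (K t, x) = cmul (x, e0 + t *\<^sub>R v)"
proof -
  note x' = inv_dom_D[OF x]
  let ?c = "\<lambda>t. cmul (x, e0 + t *\<^sub>R v)"
  have p: "((\<lambda>t. (x, e0 + t *\<^sub>R v)) has_vector_derivative (0, v)) (at 0)"
    by (auto intro!: derivative_eq_intros has_vector_derivative_Pair)
  have c: "(?c has_vector_derivative dmul (x, e0) (0, v)) (at 0)"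
    using vector_derivative_diff_chain_within[OF p, of cmul "dmul (x, e0)"]
      cmul_has_derivative[OF x'(10)] by (simp add: o_def has_derivative_at_withinI)
  have c0: "?c 0 = x" using x by (simp add: cmul_e0_right)
  have q: "((\<lambda>t. (?c t, cinv x)) has_vector_derivative (dmul (x, e0) (0, v), 0)) (at 0)"
    by (intro has_vector_derivative_Pair c has_vector_derivative_const)
  show "(K has_vector_derivative Ad_coord v x) (at 0)"
    using vector_derivative_diff_chain_within[OF q, of cmul "dmul (x, cinv x)"]
      cmul_has_derivative[OF x'(12)] c0 unfolding K_def Ad_coord_def
    by (simp add: o_def has_derivative_at_withinI)
  show "K 0 = e0" using x' by (simp add: K_def cmul_def e0_in_model)
  show "\<phi> (\<psi> x \<otimes> chart_line G \<kappa> v 0 \<otimes> inv (\<psi> x)) = e0"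
    using x' by (simp add: chart_line_def)
  have "\<forall>\<^sub>F t in at 0. (x, e0 + t *\<^sub>R v) \<in> mult_dom_ext"
    using eventually_in_open_curve[OF p open_mult_dom_ext] x' by simp
  moreover have "\<forall>\<^sub>F t in at 0. (?c t, cinv x) \<in> mult_dom_ext"
    using eventually_in_open_curve[OF q open_mult_dom_ext] x' c0 by simp
  ultimately show "\<forall>\<^sub>F t in at 0. K t = \<phi> (\<psi> x \<otimes> chart_line G \<kappa> v t \<otimes> inv (\<psi> x))
            \<and> K t \<in> E \<and> cmul (K t, x) = cmul (x, e0 + t *\<^sub>R v)"
  proof eventually_elim
    case (elim t)
    let ?y = "e0 + t *\<^sub>R v"
    have y: "?y \<in> E" using e0_in_model v line_in_model by blast
    note 1 = mult_dom_ext_D[OF elim(1) x'(2) y]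
    note 2 = mult_dom_ext_D[OF elim(2) 1(6) x'(8)]
    have yc: "\<psi> ?y \<in> carrier G" using 1 \<psi>_in_carrier by blast
    have "cmul (K t, x) = \<phi> (\<psi> (K t) \<otimes> \<psi> x)"
      using 2 x' by (simp add: cmul_def K_def)
    also have "\<psi> (K t) = \<psi> x \<otimes> \<psi> ?y \<otimes> inv (\<psi> x)" using 1 2 x' by (simp add: K_def)
    also have "\<dots> \<otimes> \<psi> x = \<psi> x \<otimes> \<psi> ?y" using yc x' by (simp add: m_assoc)
    finally have "cmul (K t, x) = cmul (x, ?y)" using 1 by simp
    then show ?case using 1 2 x' by (simp add: K_def chart_line_def)
  qed
qed

text \<open>
  The last conclusion is the identity \<open>(a p a\<inverse>) a = a p\<close> differentiated in \<open>p\<close>. It determines \<open>Ad\<close> without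
  the inversion map, whose derivatives therefore do not enter the formula for the bracket.
\<close>

lemma Ad_eq_Ad_coord:
  assumes x: "x \<in> inv_dom" and v: "v \<in> E"
  shows "Ad G \<kappa> (\<psi> x) v = Ad_coord v x" and "Ad_coord v x \<in> E"
    and "dmul (e0, x) (Ad_coord v x, 0) = dmul (x, e0) (0, v)"
proof -
  note x' = inv_dom_D[OF x]
  let ?K = "\<lambda>t. cmul (cmul (x, e0 + t *\<^sub>R v), cinv x)"
  note K = conjugation_in_chart[OF x v]
  have "((\<lambda>t. \<phi> (\<psi> x \<otimes> chart_line G \<kappa> v t \<otimes> inv (\<psi> x))) has_vector_derivative Ad_coord v x) (at 0)"
    using K(1) unfolding has_vector_derivative_def
    by (rule has_derivative_transform_eventually) (use K in \<open>auto elim: eventually_mono\<close>)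
  then show "Ad G \<kappa> (\<psi> x) v = Ad_coord v x"
    unfolding Ad_def by (rule vector_derivative_at)
  show "Ad_coord v x \<in> E"
    by (rule has_vector_derivative_in_subspace[OF K(1) subspace_model])
       (use K e0_in_model in \<open>auto elim: eventually_mono\<close>)
  have "((\<lambda>t. (?K t, x)) has_vector_derivative (Ad_coord v x, 0)) (at 0)"
    by (intro has_vector_derivative_Pair K has_vector_derivative_const)
  from vector_derivative_diff_chain_within[OF this, of cmul "dmul (e0, x)"]
  have 1: "((\<lambda>t. cmul (?K t, x)) has_vector_derivative dmul (e0, x) (Ad_coord v x, 0)) (at 0)"
    using cmul_has_derivative[OF x'(11)] K(2) by (simp add: o_def has_derivative_at_withinI)
  have p: "((\<lambda>t. (x, e0 + t *\<^sub>R v)) has_vector_derivative (0, v)) (at 0)"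
    by (auto intro!: derivative_eq_intros has_vector_derivative_Pair)
  have 2: "((\<lambda>t. cmul (x, e0 + t *\<^sub>R v)) has_vector_derivative dmul (x, e0) (0, v)) (at 0)"
    using vector_derivative_diff_chain_within[OF p, of cmul "dmul (x, e0)"]
      cmul_has_derivative[OF x'(10)] by (simp add: o_def has_derivative_at_withinI)
  have "((\<lambda>t. cmul (?K t, x)) has_vector_derivative dmul (x, e0) (0, v)) (at 0)"
    using 2 unfolding has_vector_derivative_def
    by (rule has_derivative_transform_eventually)
       (use K(2,4) x' in \<open>auto elim: eventually_mono simp: cmul_def e0_in_model\<close>)
  from vector_derivative_unique_at[OF 1 this]
  show "dmul (e0, x) (Ad_coord v x, 0) = dmul (x, e0) (0, v)" .
qed

lemma dmul_unit:
  assumes v: "v \<in> E"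
  shows "dmul (e0, e0) (v, 0) = v" "dmul (e0, e0) (0, v) = v"
proof -
  have z: "(e0, e0) \<in> mult_dom_ext" using inv_dom_D(10)[OF e0_in_inv_dom] .
  have ev: "\<forall>\<^sub>F t in at 0. e0 + t *\<^sub>R v \<in> inv_dom_ext"
    by (rule eventually_in_open_curve[OF _ open_inv_dom_ext, of _ v])
       (use inv_dom_D(13)[OF e0_in_inv_dom] in \<open>auto intro!: derivative_eq_intros\<close>)
  have ev: "\<forall>\<^sub>F t in at 0. cmul (e0 + t *\<^sub>R v, e0) = e0 + t *\<^sub>R v \<and> cmul (e0, e0 + t *\<^sub>R v) = e0 + t *\<^sub>R v"
    using ev
  proof eventually_elim
    case (elim t)
    have y: "e0 + t *\<^sub>R v \<in> E" using e0_in_model v line_in_model by blast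
    then have "e0 + t *\<^sub>R v \<in> inv_dom" using elim by (simp add: inv_dom_ext_def)
    then show ?case using inv_dom_D by (simp add: cmul_def y e0_in_model)
  qed
  have l: "((\<lambda>t. e0 + t *\<^sub>R v) has_vector_derivative v) (at 0)"
    by (auto intro!: derivative_eq_intros)
  have e: "cmul (e0, e0) = e0" using cmul_e0_right[OF e0_in_inv_dom] .
  have chain: "((\<lambda>t. cmul ((e0, e0) + t *\<^sub>R w)) has_vector_derivative dmul (e0, e0) w) (at 0)" for w
    by (rule has_vector_derivative_along_line) (use cmul_has_derivative[OF z] in simp)
  have "((\<lambda>t. cmul (e0 + t *\<^sub>R v, e0)) has_vector_derivative v) (at 0)"
       "((\<lambda>t. cmul (e0, e0 + t *\<^sub>R v)) has_vector_derivative v) (at 0)"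
    using l unfolding has_vector_derivative_def
    by (rule has_derivative_transform_eventually; use ev e in \<open>auto elim: eventually_mono\<close>)+
  with vector_derivative_unique_at chain[of "(v, 0)"] chain[of "(0, v)"]
  show "dmul (e0, e0) (v, 0) = v" "dmul (e0, e0) (0, v) = v" by fastforce+
qed

lemma Ad_coord_e0: "v \<in> E \<Longrightarrow> Ad_coord v e0 = v"
  by (simp add: Ad_coord_def dmul_unit)

lemma Ad_coord_differentiable: "Ad_coord v differentiable (at e0)"
proof -
  note e' = inv_dom_D[OF e0_in_inv_dom]
  have I: "(cinv has_derivative frechet_derivative cinv (at e0)) (at e0)"
    by (rule smooth_on_differentiable(1)[OF open_inv_dom_ext smooth_cinv e'(13)])
  have w: "((\<lambda>x. (dmul (x, e0) (0, v), 0 :: 'e)) has_derivative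
     (\<lambda>h. (ddmul (e0, e0) (0, v) (h, 0), 0))) (at e0)"
  proof (rule has_derivative_Pair[OF _ has_derivative_const])
    have "((\<lambda>x. (x, e0)) has_derivative (\<lambda>h. (h, 0))) (at e0)"
      by (auto intro!: derivative_eq_intros)
    from diff_chain_at[OF this dmul_has_derivative[OF e'(10), of "(0, v)"]]
    show "((\<lambda>x. dmul (x, e0) (0, v)) has_derivative (\<lambda>h. ddmul (e0, e0) (0, v) (h, 0))) (at e0)"
      by (simp add: o_def)
  qed
  have z: "((\<lambda>x. (x, cinv x)) has_derivative (\<lambda>h. (h, frechet_derivative cinv (at e0) h))) (at e0)"
    by (intro has_derivative_Pair has_derivative_ident I)
  show ?thesis
    unfolding Ad_coord_def[abs_def] differentiable_def
    by (rule exI, rule has_derivative_linear_family[OF z w open_mult_dom_ext _ linear_dmul dmul_has_derivative])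
       (use e' in auto)
qed

text \<open>
  By the chain rule the derivative depends only on the velocity of the curve. The bracket, defined by
  means of the chart line, may thus be computed along a one-parameter subgroup instead.
\<close>

lemma Ad_along_curve:
  assumes v: "v \<in> E" and c: "(c has_vector_derivative u) (at 0)" and c0: "c 0 = e0"
    and cE: "\<forall>\<^sub>F t in at 0. c t \<in> E"
  shows "((\<lambda>t. Ad G \<kappa> (\<psi> (c t)) v) has_vector_derivative frechet_derivative (Ad_coord v) (at e0) u) (at 0)"
    and "\<forall>\<^sub>F t in at 0. c t \<in> inv_dom"
proof -
  have "\<forall>\<^sub>F t in at 0. c t \<in> inv_dom_ext"
    by (rule eventually_in_open_curve[OF c open_inv_dom_ext]) (use inv_dom_D(13)[OF e0_in_inv_dom] c0 in simp)
  with cE show ev: "\<forall>\<^sub>F t in at 0. c t \<in> inv_dom"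
    by eventually_elim (simp add: inv_dom_ext_def)
  have "(Ad_coord v has_derivative frechet_derivative (Ad_coord v) (at e0)) (at e0)"
    using Ad_coord_differentiable frechet_derivative_works by blast
  with vector_derivative_diff_chain_within[OF c, of "Ad_coord v"]
  have "((\<lambda>t. Ad_coord v (c t)) has_vector_derivative frechet_derivative (Ad_coord v) (at e0) u) (at 0)"
    by (simp add: o_def has_derivative_at_withinI c0)
  then show "((\<lambda>t. Ad G \<kappa> (\<psi> (c t)) v) has_vector_derivative frechet_derivative (Ad_coord v) (at e0) u) (at 0)"
    unfolding has_vector_derivative_def
    by (rule has_derivative_transform_eventually)
       (use ev Ad_eq_Ad_coord(1)[OF _ v] Ad_eq_Ad_coord(1)[OF e0_in_inv_dom v] c0
         in \<open>auto elim: eventually_mono\<close>)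
qed

lemma model_line:
  assumes "u \<in> E"
  shows "((\<lambda>t. e0 + t *\<^sub>R u) has_vector_derivative u) (at 0)"
    and "\<forall>\<^sub>F t in at 0. e0 + t *\<^sub>R u \<in> E"
  using assms e0_in_model line_in_model by (auto intro!: derivative_eq_intros)

lemma bracket_eq_derivative_Ad_coord:
  assumes "u \<in> E" "v \<in> E"
  shows "bracket G \<kappa> u v = frechet_derivative (Ad_coord v) (at e0) u"
  unfolding bracket_def chart_line_def
  by (rule vector_derivative_at[OF Ad_along_curve(1)[OF \<open>v \<in> E\<close> model_line(1)[OF \<open>u \<in> E\<close>] _ model_line(2)]])
     (use assms in auto)

lemma bracket_in_model:
  assumes u: "u \<in> E" and v: "v \<in> E"
  shows "bracket G \<kappa> u v \<in> E"
proof -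
  note c = Ad_along_curve[OF v model_line(1)[OF u] _ model_line(2)[OF u]]
  have "\<forall>\<^sub>F t in at 0. Ad G \<kappa> (\<psi> (e0 + t *\<^sub>R u)) v \<in> E"
    using c(2) by (auto elim!: eventually_mono simp: Ad_eq_Ad_coord v)
  then have "frechet_derivative (Ad_coord v) (at e0) u \<in> E"
    by (intro has_vector_derivative_in_subspace[OF c(1) subspace_model])
       (use Ad_eq_Ad_coord[OF e0_in_inv_dom v] in auto)
  then show ?thesis by (simp add: bracket_eq_derivative_Ad_coord u v)
qed

text \<open>
  Both sides of \<open>D\<mu>(e, x) (Ad\<^sub>x v, 0) = D\<mu>(x, e) (0, v)\<close> are differentiated along \<open>x = e + t u\<close>. On the
  left, the derivative of \<open>Ad\<close> contributes \<open>D\<mu>(e, e) ([u, v], 0) = [u, v]\<close>.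
\<close>

lemma bracket_eq_second_derivatives:
  assumes u: "u \<in> E" and v: "v \<in> E"
  shows "bracket G \<kappa> u v = ddmul (e0, e0) (0, v) (u, 0) - ddmul (e0, e0) (v, 0) (0, u)"
proof -
  note e' = inv_dom_D[OF e0_in_inv_dom]
  let ?A = "frechet_derivative (Ad_coord v) (at e0)"
  have A: "(Ad_coord v has_derivative ?A) (at e0)"
    using Ad_coord_differentiable frechet_derivative_works by blast
  have z: "((\<lambda>x. (e0, x)) has_derivative (\<lambda>h. (0, h))) (at e0)"
    by (auto intro!: derivative_eq_intros)
  have w: "((\<lambda>x. (Ad_coord v x, 0::'e)) has_derivative (\<lambda>h. (?A h, 0))) (at e0)"
    by (intro has_derivative_Pair A has_derivative_const)
  have L: "((\<lambda>x. dmul (e0, x) (Ad_coord v x, 0)) has_derivative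
     (\<lambda>h. ddmul (e0, e0) (Ad_coord v e0, 0) (0, h) + dmul (e0, e0) (?A h, 0))) (at e0)"
    by (rule has_derivative_linear_family[OF z w open_mult_dom_ext _ linear_dmul dmul_has_derivative])
       (use e' in auto)
  have "((\<lambda>x. (x, e0)) has_derivative (\<lambda>h. (h, 0))) (at e0)"
    by (auto intro!: derivative_eq_intros)
  from diff_chain_at[OF this dmul_has_derivative[OF e'(10), of "(0, v)"]]
  have R: "((\<lambda>x. dmul (x, e0) (0, v)) has_derivative (\<lambda>h. ddmul (e0, e0) (0, v) (h, 0))) (at e0)"
    by (simp add: o_def)
  have "((\<lambda>t. dmul (e0, e0 + t *\<^sub>R u) (Ad_coord v (e0 + t *\<^sub>R u), 0)) has_vector_derivative
     ddmul (e0, e0) (Ad_coord v e0, 0) (0, u) + dmul (e0, e0) (?A u, 0)) (at 0)"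
    by (rule has_vector_derivative_along_line) (use L in simp)
  moreover have "((\<lambda>t. dmul (e0, e0 + t *\<^sub>R u) (Ad_coord v (e0 + t *\<^sub>R u), 0)) has_vector_derivative
     ddmul (e0, e0) (0, v) (u, 0)) (at 0)"
  proof -
    have "((\<lambda>t. dmul (e0 + t *\<^sub>R u, e0) (0, v)) has_vector_derivative ddmul (e0, e0) (0, v) (u, 0)) (at 0)"
      by (rule has_vector_derivative_along_line) (use R in simp)
    then show ?thesis
      unfolding has_vector_derivative_def
      by (rule has_derivative_transform_eventually)
         (use Ad_along_curve(2)[OF v model_line(1)[OF u] _ model_line(2)[OF u]]
            Ad_eq_Ad_coord(3)[OF _ v] e0_in_inv_dom in \<open>auto elim: eventually_mono\<close>)
  qed
  ultimately have "ddmul (e0, e0) (Ad_coord v e0, 0) (0, u) + dmul (e0, e0) (?A u, 0) = ddmul (e0, e0) (0, v) (u, 0)"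
    by (rule vector_derivative_unique_at)
  moreover have "?A u \<in> E"
    using bracket_in_model[OF u v] by (simp add: bracket_eq_derivative_Ad_coord u v)
  ultimately show ?thesis
    by (simp add: bracket_eq_derivative_Ad_coord u v Ad_coord_e0 dmul_unit algebra_simps)
qed

lemma bracket_antisym:
  assumes "u \<in> E" "v \<in> E"
  shows "bracket G \<kappa> v u = - bracket G \<kappa> u v"
proof -
  have z: "(e0, e0) \<in> mult_dom_ext" using inv_dom_D(10)[OF e0_in_inv_dom] .
  show ?thesis
    unfolding bracket_eq_second_derivatives[OF assms] bracket_eq_second_derivatives[OF assms(2,1)]
      ddmul_symmetric[OF z, of "(0, u)" "(v, 0)"] ddmul_symmetric[OF z, of "(0, v)" "(u, 0)"]
    by simp
qed

text \<open>
  Along the one-parameter subgroup in \<open>H\<close> with velocity \<open>u\<close>, the vectors \<open>Ad(\<gamma>(t)) v\<close> stay in \<open>W\<close>, and a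
  subspace of a finite-dimensional space is closed.
\<close>

lemma bracket_in_Ad_invariant_subspace:
  assumes H: "subgroup H G" and W: "subspace W" "W \<subseteq> E"
    and inv: "\<And>a. a \<in> H \<Longrightarrow> Ad G \<kappa> a ` W \<subseteq> W"
    and u: "u \<in> subgroup_lie_algebra G \<kappa> H" and v: "v \<in> W"
  shows "bracket G \<kappa> u v \<in> W"
proof -
  obtain \<gamma> where uE: "u \<in> E" and \<gamma>: "continuous_map euclideanreal (gtop G) \<gamma>"
    "\<And>s t. \<gamma> (s + t) = \<gamma> s \<otimes> \<gamma> t" "((\<lambda>t. \<phi> (\<gamma> t)) has_vector_derivative u) (at 0)"
    and \<gamma>H: "\<And>t. \<gamma> t \<in> H"
    using u unfolding subgroup_lie_algebra_def one_parameter_subgroup_def by blast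
  have vE: "v \<in> E" using v W by auto
  have "\<gamma> 0 \<in> carrier G" using subgroup.mem_carrier[OF H \<gamma>H] .
  moreover have "\<gamma> 0 \<otimes> \<gamma> 0 = \<gamma> 0" using \<gamma>(2)[of 0 0] by simp
  ultimately have \<gamma>0: "\<gamma> 0 = \<one>" using l_cancel_one[of "\<gamma> 0" "\<gamma> 0"] by simp
  have "open {t. \<gamma> t \<in> U}"
    using openin_continuous_map_preimage[OF \<gamma>(1) openin_U] by simp
  then have ev: "\<forall>\<^sub>F t in at 0. \<gamma> t \<in> U"
    using \<gamma>0 one_in_U unfolding eventually_at_topological by (intro exI[of _ "{t. \<gamma> t \<in> U}"]) simp
  then have evE: "\<forall>\<^sub>F t in at 0. \<phi> (\<gamma> t) \<in> E"
    using image_subset_model by (auto elim!: eventually_mono)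
  have c: "((\<lambda>t. Ad G \<kappa> (\<psi> (\<phi> (\<gamma> t))) v) has_vector_derivative
      frechet_derivative (Ad_coord v) (at e0) u) (at 0)"
    by (rule Ad_along_curve(1)[OF vE \<gamma>(3) _ evE]) (simp add: \<gamma>0)
  have "\<forall>\<^sub>F t in at 0. Ad G \<kappa> (\<psi> (\<phi> (\<gamma> t))) v \<in> W"
    using ev by (rule eventually_mono) (use inv[OF \<gamma>H] v in \<open>simp add: image_subset_iff\<close>)
  moreover have "Ad G \<kappa> (\<psi> (\<phi> (\<gamma> 0))) v \<in> W"
    using inv[OF \<gamma>H, of 0] v one_in_U by (simp add: \<gamma>0 image_subset_iff)
  ultimately have "frechet_derivative (Ad_coord v) (at e0) u \<in> W"
    by (intro has_vector_derivative_in_subspace[OF c W(1)])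
  then show ?thesis by (simp add: bracket_eq_derivative_Ad_coord uE vE)
qed

end

section \<open>Minkowski norms\<close>

lemma fundamental_tensor_eqI:
  assumes "\<forall>\<^sub>F s in nhds 0. ((\<lambda>t. (F (y + s *\<^sub>R u + t *\<^sub>R v))\<^sup>2) has_real_derivative g s) (at 0)"
    and "(g has_real_derivative D) (at 0)"
  shows "fundamental_tensor F y u v = D / 2"
proof -
  have "\<forall>\<^sub>F s in nhds 0. deriv (\<lambda>t. (F (y + s *\<^sub>R u + t *\<^sub>R v))\<^sup>2) 0 = g s"
    using assms(1) by eventually_elim (rule DERIV_imp_deriv)
  then have "deriv (\<lambda>s. deriv (\<lambda>t. (F (y + s *\<^sub>R u + t *\<^sub>R v))\<^sup>2) 0) 0 = deriv g 0"
    by (rule deriv_cong_ev) simp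
  then show ?thesis
    using DERIV_imp_deriv[OF assms(2)] by (simp add: fundamental_tensor_def)
qed

lemma eventually_nhds_0_scale:
  assumes "\<forall>\<^sub>F s in nhds (0::real). P s"
  shows "\<forall>\<^sub>F s in nhds 0. P (r * s)"
proof -
  have "((\<lambda>s. r * s) \<longlongrightarrow> r * 0) (nhds 0)"
    by (intro tendsto_mult tendsto_const filterlim_ident)
  then have "filterlim (\<lambda>s. r * s) (nhds 0) (nhds 0)" by simp
  from eventually_compose_filterlim[OF assms this] show ?thesis .
qed

context
  fixes V :: "'a::real_normed_vector set" and F :: "'a \<Rightarrow> real"
  assumes V: "subspace V" and F: "minkowski_norm V F"
begin

text \<open>
  The operator \<open>deriv\<close> says nothing where a derivative fails to exist. This lemma supplies existence of
  both derivatives in the fundamental tensor, in a form that can be transformed by the chain rule and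
  fed back to \<open>fundamental_tensor_eqI\<close>.
\<close>

lemma fundamental_tensor_derivatives:
  assumes y: "y \<in> V - {0}" and u: "u \<in> V" and v: "v \<in> V"
  obtains g where
    "\<forall>\<^sub>F s in nhds 0. ((\<lambda>t. (F (y + s *\<^sub>R u + t *\<^sub>R v))\<^sup>2) has_real_derivative g s) (at 0)"
    and "(g has_real_derivative 2 * fundamental_tensor F y u v) (at 0)"
proof -
  have "Ck_on (Suc (Suc 0)) V (V - {0}) F"
    using F by (simp only: minkowski_norm_def smooth_on_def)
  then have *: "\<exists>f. (\<forall>x\<in>V - {0}. ((\<lambda>t. F (x + t *\<^sub>R w)) has_vector_derivative f x) (at 0))
      \<and> Ck_on (Suc 0) V (V - {0}) f" if "w \<in> V" for w
    using that by simp
  obtain Fu where Fu: "\<And>x. x \<in> V - {0} \<Longrightarrow> ((\<lambda>t. F (x + t *\<^sub>R u)) has_vector_derivative Fu x) (at 0)"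
    using *[OF u] by blast
  obtain Fv where Fv: "\<And>x. x \<in> V - {0} \<Longrightarrow> ((\<lambda>t. F (x + t *\<^sub>R v)) has_vector_derivative Fv x) (at 0)"
    and "Ck_on (Suc 0) V (V - {0}) Fv"
    using *[OF v] by blast
  then obtain Fuv where
    Fuv: "\<And>x. x \<in> V - {0} \<Longrightarrow> ((\<lambda>t. Fv (x + t *\<^sub>R u)) has_vector_derivative Fuv x) (at 0)"
    using u by (simp only: Ck_on.simps) blast
  define g where "g s = 2 * F (y + s *\<^sub>R u) * Fv (y + s *\<^sub>R u)" for s
  have "((\<lambda>s. y + s *\<^sub>R u) \<longlongrightarrow> y + 0 *\<^sub>R u) (nhds 0)"
    by (intro tendsto_intros filterlim_ident)
  then have "\<forall>\<^sub>F s in nhds 0. y + s *\<^sub>R u \<noteq> 0"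
    using y by (intro tendsto_imp_eventually_ne[of _ y]) auto
  then have 1: "\<forall>\<^sub>F s in nhds 0. ((\<lambda>t. (F (y + s *\<^sub>R u + t *\<^sub>R v))\<^sup>2) has_real_derivative g s) (at 0)"
  proof eventually_elim
    case (elim s)
    then have "y + s *\<^sub>R u \<in> V - {0}" using V y u by (auto intro: subspace_add subspace_mul)
    from Fv[OF this] have "((\<lambda>t. F (y + s *\<^sub>R u + t *\<^sub>R v)) has_real_derivative Fv (y + s *\<^sub>R u)) (at 0)"
      by (simp add: has_real_derivative_iff_has_vector_derivative)
    then show ?case by (auto intro!: derivative_eq_intros simp: g_def)
  qed
  have "((\<lambda>s. F (y + s *\<^sub>R u)) has_real_derivative Fu y) (at 0)"
    "((\<lambda>s. Fv (y + s *\<^sub>R u)) has_real_derivative Fuv y) (at 0)"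
    using Fu[OF y] Fuv[OF y] by (simp_all add: has_real_derivative_iff_has_vector_derivative)
  from DERIV_mult[OF this]
  have "((\<lambda>s. 2 * (F (y + s *\<^sub>R u) * Fv (y + s *\<^sub>R u))) has_real_derivative
      2 * (Fu y * Fv (y + 0 *\<^sub>R u) + Fuv y * F (y + 0 *\<^sub>R u))) (at 0)"
    by (rule DERIV_cmult)
  then have 2: "(g has_real_derivative 2 * (Fu y * Fv y + Fuv y * F y)) (at 0)"
    by (simp add: g_def[abs_def] mult.assoc)
  then have "2 * (Fu y * Fv y + Fuv y * F y) = 2 * fundamental_tensor F y u v"
    using fundamental_tensor_eqI[OF 1 2] by simp
  with 1 2 show ?thesis using that by simp
qed

lemma fundamental_tensor_scale:
  assumes y: "y \<in> V - {0}" and u: "u \<in> V" and v: "v \<in> V"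
  shows "fundamental_tensor F y (r *\<^sub>R u) v = r * fundamental_tensor F y u v"
proof -
  obtain g where
    1: "\<forall>\<^sub>F s in nhds 0. ((\<lambda>t. (F (y + s *\<^sub>R u + t *\<^sub>R v))\<^sup>2) has_real_derivative g s) (at 0)"
    and 2: "(g has_real_derivative 2 * fundamental_tensor F y u v) (at 0)"
    using fundamental_tensor_derivatives[OF assms] by blast
  have "\<forall>\<^sub>F s in nhds 0. ((\<lambda>t. (F (y + s *\<^sub>R (r *\<^sub>R u) + t *\<^sub>R v))\<^sup>2) has_real_derivative g (r * s)) (at 0)"
    using eventually_nhds_0_scale[OF 1, of r] by (simp add: mult.commute)
  moreover have "((\<lambda>s. g (r * s)) has_real_derivative 2 * fundamental_tensor F y u v * r) (at 0)"
    by (rule DERIV_chain2[of g]) (use 2 in \<open>auto intro!: derivative_eq_intros\<close>)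
  ultimately show ?thesis using fundamental_tensor_eqI by fastforce
qed

text \<open>
  \<open>F\<^sup>2\<close> is homogeneous of degree \<open>2\<close>, and each of the two differentiations lowers the degree by one.
\<close>

lemma fundamental_tensor_homogeneous:
  assumes y: "y \<in> V - {0}" and u: "u \<in> V" and v: "v \<in> V" and c: "c > 0"
  shows "fundamental_tensor F (c *\<^sub>R y) u v = fundamental_tensor F y u v"
proof -
  obtain g where
    1: "\<forall>\<^sub>F s in nhds 0. ((\<lambda>t. (F (y + s *\<^sub>R u + t *\<^sub>R v))\<^sup>2) has_real_derivative g s) (at 0)"
    and 2: "(g has_real_derivative 2 * fundamental_tensor F y u v) (at 0)"
    using fundamental_tensor_derivatives[OF y u v] by blast
  have F_scale: "(F (c *\<^sub>R y + s *\<^sub>R u + t *\<^sub>R v))\<^sup>2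
      = c\<^sup>2 * (F (y + (inverse c * s) *\<^sub>R u + (inverse c * t) *\<^sub>R v))\<^sup>2" for s t
  proof -
    let ?w = "y + (inverse c * s) *\<^sub>R u + (inverse c * t) *\<^sub>R v"
    have "?w \<in> V" using V y u v by (auto intro!: subspace_add subspace_mul)
    then have "F (c *\<^sub>R ?w) = c * F ?w" using F c by (simp add: minkowski_norm_def)
    moreover have "c *\<^sub>R ?w = c *\<^sub>R y + s *\<^sub>R u + t *\<^sub>R v"
      using c by (simp add: scaleR_add_right mult.assoc[symmetric])
    ultimately show ?thesis by (simp add: power_mult_distrib)
  qed
  have "\<forall>\<^sub>F s in nhds 0. ((\<lambda>t. (F (c *\<^sub>R y + s *\<^sub>R u + t *\<^sub>R v))\<^sup>2) has_real_derivative c * g (inverse c * s)) (at 0)"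
    using eventually_nhds_0_scale[OF 1, of "inverse c"]
  proof eventually_elim
    case (elim s)
    have "((\<lambda>t. (F (y + (inverse c * s) *\<^sub>R u + (inverse c * t) *\<^sub>R v))\<^sup>2) has_real_derivative
        g (inverse c * s) * inverse c) (at 0)"
      by (rule DERIV_chain2[of "\<lambda>t. (F (y + (inverse c * s) *\<^sub>R u + t *\<^sub>R v))\<^sup>2"])
         (use elim in \<open>auto intro!: derivative_eq_intros\<close>)
    have "c\<^sup>2 * (g (inverse c * s) * inverse c) = c * g (inverse c * s)"
      using c by (simp add: power2_eq_square)
    with DERIV_cmult[OF \<open>(_ has_real_derivative g (inverse c * s) * inverse c) (at 0)\<close>, of "c\<^sup>2"]
    show ?case unfolding F_scale by (simp only:)
  qed
  moreover have "((\<lambda>s. c * g (inverse c * s)) has_real_derivative 2 * fundamental_tensor F y u v) (at 0)"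
  proof -
    have "((\<lambda>s. g (inverse c * s)) has_real_derivative 2 * fundamental_tensor F y u v * inverse c) (at 0)"
      by (rule DERIV_chain2[of g]) (use 2 in \<open>auto intro!: derivative_eq_intros\<close>)
    from DERIV_cmult[OF this, of c]
    have "((\<lambda>s. c * g (inverse c * s)) has_real_derivative
        c * (2 * fundamental_tensor F y u v * inverse c)) (at 0)" .
    also have "c * (2 * fundamental_tensor F y u v * inverse c) = 2 * fundamental_tensor F y u v"
      using c by simp
    finally show ?thesis .
  qed
  ultimately show ?thesis using fundamental_tensor_eqI by fastforce
qed

text \<open>
  Along the ray through \<open>y\<close> the fundamental tensor is constant.
\<close>

lemma cartan_tensor_base_point:
  assumes y: "y \<in> V - {0}" and u: "u \<in> V" and v: "v \<in> V"
  shows "cartan_tensor F y u v y = 0"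
proof -
  have "\<forall>\<^sub>F t in nhds 0. fundamental_tensor F (y + t *\<^sub>R y) u v = fundamental_tensor F y u v"
  proof -
    have "\<forall>\<^sub>F t::real in nhds 0. t > -1"
      using eventually_nhds_in_open[of "{-1<..}" "0::real"] by simp
    then show ?thesis
    proof eventually_elim
      case (elim t)
      then show ?case
        using fundamental_tensor_homogeneous[OF assms, of "1 + t"] by (simp add: scaleR_add_left)
    qed
  qed
  then have "deriv (\<lambda>t. fundamental_tensor F (y + t *\<^sub>R y) u v) 0 = deriv (\<lambda>t. fundamental_tensor F y u v) 0"
    by (rule deriv_cong_ev) simp
  then show ?thesis by (simp add: cartan_tensor_def)
qed

text \<open>
  For \<open>y \<noteq> 0\<close>, the two conditions at \<open>y\<close> with third vector \<open>w = B x y\<close> give \<open>fundamental_tensor F y w w = 0\<close>.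
  The fundamental tensor at \<open>0\<close> carries no information; there \<open>B x 0 = - B 0 x\<close> leads back to the
  first case, or to \<open>B 0 0 = - B 0 0\<close>.
\<close>

lemma cyclic_naturally_reductive_imp_zero:
  fixes B :: "'a \<Rightarrow> 'a \<Rightarrow> 'a"
  assumes B: "\<And>x y. x \<in> V \<Longrightarrow> y \<in> V \<Longrightarrow> B x y \<in> V"
    and antisym: "\<And>x y. x \<in> V \<Longrightarrow> y \<in> V \<Longrightarrow> B y x = - B x y"
    and cyc: "\<And>x y z. y \<in> V - {0} \<Longrightarrow> x \<in> V \<Longrightarrow> z \<in> V \<Longrightarrow>
      fundamental_tensor F y (B x y) z + fundamental_tensor F y (B y z) x + fundamental_tensor F y (B z x) y = 0"
    and natred: "\<And>x y u v. y \<in> V - {0} \<Longrightarrow> x \<in> V \<Longrightarrow> u \<in> V \<Longrightarrow> v \<in> V \<Longrightarrow>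
      fundamental_tensor F y (B x u) v + fundamental_tensor F y (B x v) u + 2 * cartan_tensor F y (B x y) u v = 0"
    and x: "x \<in> V" and y: "y \<in> V"
  shows "B x y = 0"
proof -
  have main: "B x y = 0" if x: "x \<in> V" and y: "y \<in> V - {0}" for x y
  proof (rule ccontr)
    have yV: "y \<in> V" using y by simp
    have minus: "fundamental_tensor F y (B b a) c = - fundamental_tensor F y (B a b) c"
      if "a \<in> V" "b \<in> V" "c \<in> V" for a b c
      using fundamental_tensor_scale[OF y B[OF that(1,2)] that(3), of "-1"] antisym[OF that(1,2)] by simp
    have skew: "fundamental_tensor F y (B a b) y = - fundamental_tensor F y (B a y) b"
      if "a \<in> V" "b \<in> V" for a b
      using natred[OF y that yV] cartan_tensor_base_point[OF y B[OF that(1) yV] that(2)] by simp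
    \<comment> \<open>The cyclic identity is used for \<open>(x, y, w)\<close> and for \<open>(w, y, x)\<close>.\<close>
    define w where "w = B x y"
    have w: "w \<in> V" using B[OF x yV] by (simp add: w_def)
    have "fundamental_tensor F y (B x y) w + fundamental_tensor F y (B y w) x + fundamental_tensor F y (B w x) y = 0"
         "fundamental_tensor F y (B w y) x + fundamental_tensor F y (B y x) w + fundamental_tensor F y (B x w) y = 0"
      using cyc[OF y x w] cyc[OF y w x] by auto
    moreover note skew[OF w x] skew[OF x w] minus[OF x w yV] minus[OF yV w x] minus[OF x yV w]
    ultimately have "fundamental_tensor F y (B x y) w = 0" by linarith
    then have "fundamental_tensor F y w w = 0" by (simp add: w_def)
    moreover assume "B x y \<noteq> 0"
    then have "0 < fundamental_tensor F y w w" using F y w by (auto simp: minkowski_norm_def w_def)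
    ultimately show False by simp
  qed
  show ?thesis
  proof (cases "y = 0")
    case False
    then show ?thesis using main x y by simp
  next
    case True
    show ?thesis
    proof (cases "x = 0")
      case True
      then have "B x y = - B x y" using antisym[OF x y] \<open>y = 0\<close> by simp
      then have "2 *\<^sub>R B x y = 0" by (simp add: scaleR_2 eq_neg_iff_add_eq_0)
      then show ?thesis by simp
    next
      case False
      then show ?thesis using main[of y x] antisym[OF y x] x y by simp
    qed
  qed
qed

end

section \<open>The Cartan decomposition\<close>

lemma direct_sum_component_unique:
  assumes "direct_sum W A B" "a \<in> A" "b \<in> B" "a' \<in> A" "b' \<in> B" "a + b = a' + b'"
  shows "b = b'"
proof -
  have "b - b' = a' - a" using assms(6) by (simp add: algebra_simps)
  moreover have "b - b' \<in> B" "a' - a \<in> A"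
    using assms by (auto simp: direct_sum_def intro: subspace_diff)
  ultimately have "b - b' \<in> A \<inter> B" by simp
  moreover have "A \<inter> B = {0}" using assms(1) by (simp add: direct_sum_def)
  ultimately have "b - b' \<in> {0}" by blast
  then show ?thesis by simp
qed

lemma bracket_m_eqI:
  assumes "direct_sum W (subgroup_lie_algebra G \<kappa> H) \<mm>"
    and "a \<in> subgroup_lie_algebra G \<kappa> H" "w \<in> \<mm>" "bracket G \<kappa> x y = a + w"
  shows "bracket_m G \<kappa> H \<mm> x y = w"
  unfolding bracket_m_def
proof (rule the_equality)
  show "w \<in> \<mm> \<and> (\<exists>a\<in>subgroup_lie_algebra G \<kappa> H. bracket G \<kappa> x y = a + w)"
    using assms by blast
next
  fix w' assume "w' \<in> \<mm> \<and> (\<exists>a\<in>subgroup_lie_algebra G \<kappa> H. bracket G \<kappa> x y = a + w')"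
  then obtain a' where "w' \<in> \<mm>" "a' \<in> subgroup_lie_algebra G \<kappa> H" "a' + w' = a + w"
    using assms(4) by auto
  then show "w' = w"
    using direct_sum_component_unique[OF assms(1)] assms(2,3) by blast
qed

theorem theorem1p1:
  fixes G :: "('g, 'e::euclidean_space, 'z) lie_group_data_scheme"
    and \<kappa> :: "('g, 'e) chart"
    and H :: "'g set"
    and \<mm> :: "'e set"
    and F :: "'e \<Rightarrow> real"
  assumes "homogeneous_finsler G \<kappa> H \<mm> F"
    and "cyclic G \<kappa> H \<mm> F"
    and "naturally_reductive G \<kappa> H \<mm> F"
  shows "cartan_decomposition G \<kappa> H \<mm>"
proof -
  define \<hh> where "\<hh> = subgroup_lie_algebra G \<kappa> H"
  have "lie_group G" "chart_at_one G \<kappa>" and H: "subgroup H G"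
    and red: "reductive_decomposition G \<kappa> H \<mm>" and F: "minkowski_norm \<mm> F"
    using assms(1) by (auto simp: homogeneous_finsler_def closed_subgroup_def)
  then interpret lie_group_chart G \<kappa>
    by (intro lie_group_chart.intro lie_group_chart_axioms.intro)
  have ds: "direct_sum (model G) \<hh> \<mm>"
    and Ad_h: "\<And>a. a \<in> H \<Longrightarrow> Ad G \<kappa> a ` \<hh> \<subseteq> \<hh>" and Ad_m: "\<And>a. a \<in> H \<Longrightarrow> Ad G \<kappa> a ` \<mm> \<subseteq> \<mm>"
    using red by (auto simp: reductive_decomposition_def \<hh>_def)
  then have h: "subspace \<hh>" and m: "subspace \<mm>"
    and sum: "model G = {a + b | a b. a \<in> \<hh> \<and> b \<in> \<mm>}"
    by (auto simp: direct_sum_def)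
  have h_sub: "\<hh> \<subseteq> model G" and m_sub: "\<mm> \<subseteq> model G"
    using subspace_0[OF h] subspace_0[OF m] unfolding sum by force+
  have model_m: "x \<in> model G" if "x \<in> \<mm>" for x using that m_sub by blast
  have split: "\<exists>a\<in>\<hh>. \<exists>w\<in>\<mm>. bracket G \<kappa> x y = a + w \<and> bracket_m G \<kappa> H \<mm> x y = w"
    if "x \<in> \<mm>" "y \<in> \<mm>" for x y
  proof -
    have "bracket G \<kappa> x y \<in> {a + b | a b. a \<in> \<hh> \<and> b \<in> \<mm>}"
      using bracket_in_model[OF that[THEN model_m]] unfolding sum .
    then obtain a w where aw: "a \<in> \<hh>" "w \<in> \<mm>" "bracket G \<kappa> x y = a + w" by blast
    moreover have "bracket_m G \<kappa> H \<mm> x y = w"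
      using bracket_m_eqI[OF ds[unfolded \<hh>_def] aw[unfolded \<hh>_def]] .
    ultimately show ?thesis by blast
  qed
  have antisym: "bracket_m G \<kappa> H \<mm> y x = - bracket_m G \<kappa> H \<mm> x y"
    if xy: "x \<in> \<mm>" "y \<in> \<mm>" for x y
  proof -
    obtain a w where aw: "a \<in> \<hh>" "w \<in> \<mm>" "bracket G \<kappa> x y = a + w" "bracket_m G \<kappa> H \<mm> x y = w"
      using split[OF xy] by blast
    have "bracket G \<kappa> y x = - a + - w"
      unfolding bracket_antisym[OF xy[THEN model_m]] aw(3) by simp
    from bracket_m_eqI[OF ds[unfolded \<hh>_def] subspace_neg[OF h aw(1), unfolded \<hh>_def]
        subspace_neg[OF m aw(2)] this]
    show ?thesis using aw(4) by simp
  qed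
  have zero: "bracket_m G \<kappa> H \<mm> x y = 0" if xy: "x \<in> \<mm>" "y \<in> \<mm>" for x y
  proof (rule cyclic_naturally_reductive_imp_zero[OF m F, where B = "bracket_m G \<kappa> H \<mm>"])
    show "bracket_m G \<kappa> H \<mm> x y \<in> \<mm>" if "x \<in> \<mm>" "y \<in> \<mm>" for x y
      using split[OF that] by blast
    show "bracket_m G \<kappa> H \<mm> y x = - bracket_m G \<kappa> H \<mm> x y" if "x \<in> \<mm>" "y \<in> \<mm>" for x y
      using antisym[OF that] .
  qed (use assms(2,3) xy in \<open>auto simp: cyclic_def naturally_reductive_def\<close>)
  have "bracket G \<kappa> x y \<in> \<hh>" if "x \<in> \<mm>" "y \<in> \<mm>" for x y
    using split[OF that] unfolding zero[OF that] by auto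
  moreover have "bracket G \<kappa> x y \<in> \<hh>" if "x \<in> \<hh>" "y \<in> \<hh>" for x y
    using bracket_in_Ad_invariant_subspace[OF H h h_sub Ad_h] that unfolding \<hh>_def by blast
  moreover have "bracket G \<kappa> x y \<in> \<mm>" if "x \<in> \<hh>" "y \<in> \<mm>" for x y
    using bracket_in_Ad_invariant_subspace[OF H m m_sub Ad_m] that unfolding \<hh>_def by blast
  ultimately show ?thesis
    using ds by (simp add: cartan_decomposition_def \<hh>_def)
qed

end
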